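(* Let $G$ be a simple positively LLY-curved outerplanar graph with minimum degree $\delta(G)\geq 2$. Then the maximum degree satisfies $\Delta(G)\leq 9$. Moreover, this bound is sharp: there exists a simple positively LLY-curved outerplanar graph with minimum degree at least $2$ and maximum degree exactly $9$ (for instance the fan graph on $10$ vertices, i.e. the join $K_1\vee P_9$ of a single vertex with a path on $9$ vertices).
   Context: Graphs are simple, connected and locally finite; $d(u,v)$ is the graph distance, $N(v)$ the neighborhood and $d_v=|N(v)|$ the degree. A graph is outerplanar if it has a planar embedding with all vertices on the outer face. For $\alpha\in[0,1)$ and a vertex $v$, the $\alpha$-lazy random walk is the probability measure $m_v^\alpha$ with $m_v^\alpha(v)=\alpha$, $m_v^\alpha(u)=(1-\alpha)/d_v$ for $u\in N(v)$, and $m_v^\alpha(u)=0$ otherwise. For probability measures $m_1,m_2$ on $V(G)$, $W(m_1,m_2)=\inf_A\sum_{u,v}A(u,v)d(u,v)$, the infimum over all couplings $A$ of $m_1$ and $m_2$ (the $1$-Wasserstein distance). For distinct vertices $x,y$, $\kappa_\alpha(x,y)=1-W(m_x^\alpha,m_y^\alpha)/d(x,y)$ and the Lin--Lu--Yau (LLY) Ricci curvature is $\kappa_{LLY}(x,y)=\lim_{\alpha\to1}\kappa_\alpha(x,y)/(1-\alpha)$. A graph is positively LLY-curved if $\kappa_{LLY}(x,y)>0$ for every pair of distinct vertices $x,y$ (equivalently, for every edge $xy$). *)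

theory Defs
  imports "HOL-Probability.Probability" "HOL-Library.Extended_Nat"
begin

section \<open>Graphs\<close>

type_synonym 'a graph = "'a set \<times> 'a set set"

abbreviation verts :: "'a graph \<Rightarrow> 'a set" where "verts G \<equiv> fst G"
abbreviation edges :: "'a graph \<Rightarrow> 'a set set" where "edges G \<equiv> snd G"

definition simple_graph :: "'a graph \<Rightarrow> bool" where
  "simple_graph G \<longleftrightarrow> (\<forall>e\<in>edges G. e \<subseteq> verts G \<and> card e = 2)"

definition adj :: "'a graph \<Rightarrow> ('a \<times> 'a) set" where
  "adj G = {(u, v). {u, v} \<in> edges G}"

definition connected_graph :: "'a graph \<Rightarrow> bool" where
  "connected_graph G \<longleftrightarrow> verts G \<noteq> {} \<and> (\<forall>u\<in>verts G. \<forall>v\<in>verts G. (u, v) \<in> (adj G)\<^sup>*)"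

definition nbhd :: "'a graph \<Rightarrow> 'a \<Rightarrow> 'a set" where
  "nbhd G v = {u. {v, u} \<in> edges G}"

definition locally_finite :: "'a graph \<Rightarrow> bool" where
  "locally_finite G \<longleftrightarrow> (\<forall>v\<in>verts G. finite (nbhd G v))"

definition vdegree :: "'a graph \<Rightarrow> 'a \<Rightarrow> nat" where
  "vdegree G v = card (nbhd G v)"

text \<open>Graphs may be infinite, so a priori the degrees need not be bounded; hence the
  extended naturals.\<close>

definition min_degree :: "'a graph \<Rightarrow> enat" where
  "min_degree G = (INF v\<in>verts G. enat (vdegree G v))"

definition max_degree :: "'a graph \<Rightarrow> enat" where
  "max_degree G = (SUP v\<in>verts G. enat (vdegree G v))"

text \<open>\<open>adj G ^^ n\<close> relates the vertices joined by a walk with \<open>n\<close> edges.\<close>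

definition gdist :: "'a graph \<Rightarrow> 'a \<Rightarrow> 'a \<Rightarrow> nat" where
  "gdist G u v = (LEAST n. (u, v) \<in> adj G ^^ n)"

section \<open>Outerplanar graphs\<close>

text \<open>A vertex \<open>v\<close> is drawn as the point \<open>p v\<close>, an edge \<open>e\<close> as the arc \<open>g e\<close>.\<close>

definition planar_embedding ::
  "'a graph \<Rightarrow> ('a \<Rightarrow> complex) \<Rightarrow> ('a set \<Rightarrow> real \<Rightarrow> complex) \<Rightarrow> bool" where
  "planar_embedding G p g \<longleftrightarrow>
     inj_on p (verts G) \<and>
     (\<forall>e\<in>edges G. arc (g e) \<and> {pathstart (g e), pathfinish (g e)} = p ` e \<and>
        path_image (g e) \<inter> p ` verts G = p ` e) \<and>
     (\<forall>e\<in>edges G. \<forall>f\<in>edges G. e \<noteq> f \<longrightarrow>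
        path_image (g e) \<inter> path_image (g f) = p ` (e \<inter> f))"

definition drawing ::
  "'a graph \<Rightarrow> ('a \<Rightarrow> complex) \<Rightarrow> ('a set \<Rightarrow> real \<Rightarrow> complex) \<Rightarrow> complex set" where
  "drawing G p g = p ` verts G \<union> (\<Union>e\<in>edges G. path_image (g e))"

text \<open>Faces are the components of the complement of the drawing. A finite drawing has exactly
  one unbounded face, its outer face. A drawing of an infinite graph may have several unbounded
  faces; any one of them may then serve as the outer face.\<close>

definition outerplanar :: "'a graph \<Rightarrow> bool" where
  "outerplanar G \<longleftrightarrow> (\<exists>p g F. planar_embedding G p g \<and>
     F \<in> components (- drawing G p g) \<and> \<not> bounded F \<and> p ` verts G \<subseteq> frontier F)"

section \<open>Lin--Lu--Yau curvature\<close>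

text \<open>The argument of \<open>embed_pmf\<close> is a probability mass function whenever
  \<open>0 \<le> \<alpha> \<le> 1\<close> and \<open>v\<close> has finite nonzero degree; see \<open>pmf_lazy_walk\<close>.\<close>

definition lazy_walk :: "'a graph \<Rightarrow> real \<Rightarrow> 'a \<Rightarrow> 'a pmf" where
  "lazy_walk G \<alpha> v = embed_pmf (\<lambda>u.
     if u = v then \<alpha>
     else if u \<in> nbhd G v then (1 - \<alpha>) / real (vdegree G v)
     else 0)"

definition couplings :: "'a pmf \<Rightarrow> 'a pmf \<Rightarrow> ('a \<times> 'a) pmf set" where
  "couplings m1 m2 = {A. map_pmf fst A = m1 \<and> map_pmf snd A = m2}"

definition wasserstein :: "'a graph \<Rightarrow> 'a pmf \<Rightarrow> 'a pmf \<Rightarrow> ennreal" where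
  "wasserstein G m1 m2 =
     (INF A\<in>couplings m1 m2. \<integral>\<^sup>+ (u, v). of_nat (gdist G u v) \<partial>measure_pmf A)"

definition lazy_curvature :: "'a graph \<Rightarrow> real \<Rightarrow> 'a \<Rightarrow> 'a \<Rightarrow> real" where
  "lazy_curvature G \<alpha> x y =
     1 - enn2real (wasserstein G (lazy_walk G \<alpha> x) (lazy_walk G \<alpha> y)) / real (gdist G x y)"

text \<open>The limit is one-sided because \<open>\<alpha>\<close> ranges over \<open>[0, 1)\<close>.\<close>

definition lly_curvature :: "'a graph \<Rightarrow> 'a \<Rightarrow> 'a \<Rightarrow> real" where
  "lly_curvature G x y = Lim (at_left 1) (\<lambda>\<alpha>. lazy_curvature G \<alpha> x y / (1 - \<alpha>))"

definition positively_lly_curved :: "'a graph \<Rightarrow> bool" where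
  "positively_lly_curved G \<longleftrightarrow>
     (\<forall>x\<in>verts G. \<forall>y\<in>verts G. x \<noteq> y \<longrightarrow> lly_curvature G x y > 0)"

lemma pmf_lazy_walk:
  assumes "simple_graph G" "finite (nbhd G v)" "nbhd G v \<noteq> {}" "0 \<le> \<alpha>" "\<alpha> \<le> 1"
  shows "pmf (lazy_walk G \<alpha> v) u =
    (if u = v then \<alpha>
     else if u \<in> nbhd G v then (1 - \<alpha>) / real (vdegree G v)
     else 0)"
  unfolding lazy_walk_def
proof (rule pmf_embed_pmf)
  let ?f = "\<lambda>u. if u = v then \<alpha>
     else if u \<in> nbhd G v then (1 - \<alpha>) / real (vdegree G v) else 0"
  show nn: "0 \<le> ?f x" for x
    using assms by auto
  have v: "v \<notin> nbhd G v"
    using assms(1) by (force simp: simple_graph_def nbhd_def)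
  have d: "vdegree G v \<noteq> 0"
    using assms(2,3) by (simp add: vdegree_def)
  have "(\<integral>\<^sup>+x. ennreal (?f x) \<partial>count_space UNIV) = (\<Sum>x\<in>insert v (nbhd G v). ennreal (?f x))"
    by (rule nn_integral_count_space') (use assms(2) in auto)
  also have "\<dots> = ennreal (\<Sum>x\<in>insert v (nbhd G v). ?f x)"
    by (rule sum_ennreal) (rule nn)
  also have "(\<Sum>x\<in>insert v (nbhd G v). ?f x) = \<alpha> + (\<Sum>x\<in>nbhd G v. ?f x)"
    using assms(2) v by simp
  also have "(\<Sum>x\<in>nbhd G v. ?f x) = (\<Sum>x\<in>nbhd G v. (1 - \<alpha>) / real (vdegree G v))"
    by (rule sum.cong) (use v in auto)
  also have "\<alpha> + \<dots> = 1"
    using d by (simp add: vdegree_def)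
  finally show "(\<integral>\<^sup>+x. ennreal (?f x) \<partial>count_space UNIV) = 1"
    by simp
qed

section \<open>The fan graph\<close>

text \<open>\<open>graph_join G H\<close> is the join \<open>G \<or> H\<close> for graphs with disjoint vertex sets.\<close>

definition graph_join :: "'a graph \<Rightarrow> 'a graph \<Rightarrow> 'a graph" where
  "graph_join G H =
     (verts G \<union> verts H, edges G \<union> edges H \<union> {{u, v} | u v. u \<in> verts G \<and> v \<in> verts H})"

definition path_graph :: "nat \<Rightarrow> nat graph" where
  "path_graph n = ({1..n}, {{i, Suc i} | i. 1 \<le> i \<and> i < n})"

definition fan_graph :: "nat \<Rightarrow> nat graph" where
  "fan_graph n = graph_join ({0}, {}) (path_graph n)"

end

theory Submission
  imports Defs
begin

text \<open>Upper bound. Let \<open>x\<close> have degree at least 10. Testing the curvature of an edge \<open>xy\<close> with a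
  pair of Kantorovich potentials bounds it in terms of the few neighbours of \<open>x\<close> that lie close
  to \<open>N(y) - N[x]\<close>; there are few of them because an outerplanar graph has no \<open>K\<^sub>2\<^sub>,\<^sub>3\<close> minor.
  If \<open>N(y) - N[x]\<close> is nonempty, the bound is nonpositive. Hence every neighbour of \<open>x\<close>
  has all its other neighbours in \<open>N(x)\<close>, so that \<open>N(x)\<close> induces a graph with degrees 1 and 2, and
  the end of a longest path in it gives an edge of nonpositive curvature.

  The exclusion of \<open>K\<^sub>2\<^sub>,\<^sub>3\<close> is topological: no face of a theta curve has points in the
  interior of all three arcs on its boundary.

  Sharpness. The quotient \<open>\<kappa>\<^sub>\<alpha> / (1 - \<alpha>)\<close> is nondecreasing in \<open>\<alpha>\<close>, so one transport plan of cost less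
  than \<open>d(x, y)\<close>, for a single idleness, shows that the curvature is positive.\<close>

section \<open>Theta curves\<close>

text \<open>The constant 10 arises from the count
  \<open>2 * card (near1 x y) + card (near2 x y) \<le> 8\<close>: together with the contribution 2
  of \<open>y\<close> itself, the term of the curvature bound belonging to \<open>x\<close> is at
  most 10 divided by the degree of \<open>x\<close>, while a nonempty \<open>far x y\<close> makes
  the term belonging to \<open>y\<close> at least 1, whatever the degree of \<open>y\<close>.
  Outerplanarity is given by arbitrary arcs in the plane, for a possibly infinite graph. No cyclic
  order of the vertices and no edge count is at hand, so the exclusion of K_{2,3} is extracted once
  and all counting goes through it. The minors used have a single nontrivial branch set, an
  arbitrary connected \<open>Y\<close>, which may be infinite. The curvature is a
  \<open>Lim\<close>, which says nothing unless the limit exists. Monotonicity in the idleness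
  settles existence and also makes every single idleness a lower bound.\<close>

lemma theta_curve_inside:
  fixes c1 c2 c3 :: "real \<Rightarrow> complex"
  assumes arcs: "arc c1" "arc c2" "arc c3"
    and ends: "pathstart c1 = a" "pathfinish c1 = b" "pathstart c2 = a" "pathfinish c2 = b"
      "pathstart c3 = a" "pathfinish c3 = b"
    and int: "path_image c1 \<inter> path_image c2 = {a, b}" "path_image c1 \<inter> path_image c3 = {a, b}"
      "path_image c2 \<inter> path_image c3 = {a, b}"
    and F: "connected F" "F \<inter> (path_image c1 \<union> path_image c2 \<union> path_image c3) = {}"
    and v: "v1 \<in> path_image c1 - {a, b}" "v2 \<in> path_image c2 - {a, b}" "v3 \<in> path_image c3 - {a, b}"
      "{v1, v2, v3} \<subseteq> closure F"
    and meets: "path_image c3 \<inter> inside (path_image c1 \<union> path_image c2) \<noteq> {}"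
  shows False
proof -
  let ?C = "path_image c1 \<union> path_image c2"
  let ?D1 = "path_image c1 \<union> path_image c3" and ?D2 = "path_image c2 \<union> path_image c3"
  have "a \<noteq> b"
    using arcs(1) ends by (metis arc_distinct_ends)
  \<comment> \<open>The third arc cuts the inside of the cycle into two regions. The closure of
    \<open>inside ?D1\<close> misses \<open>v2\<close>, that of \<open>inside ?D2\<close> misses
    \<open>v1\<close>, and the closure of the outside misses \<open>v3\<close>; the connected set
    \<open>F\<close> lies in one of these three.\<close>
  obtain split: "inside ?D1 \<inter> inside ?D2 = {}"
      "inside ?D1 \<union> inside ?D2 \<union> (path_image c3 - {a, b}) = inside ?C"
    using split_inside_simple_closed_curve [of c1 a b c2 c3] arcs ends int meets \<open>a \<noteq> b\<close>
    by (metis arc_imp_simple_path)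
  have closed: "closed (path_image c1)" "closed (path_image c2)" "closed (path_image c3)"
    using arcs by (simp_all add: closed_arc_image)
  then have opens: "open (inside ?C)" "open (outside ?C)" "open (inside ?D1)" "open (inside ?D2)"
    by (simp_all add: open_inside open_outside closed_Un)
  have "F \<noteq> {}"
    using v by auto
  have "F \<subseteq> inside ?C \<or> F \<subseteq> outside ?C"
    using connectedD [OF F(1) opens(1,2)] F(2) inside_Un_outside [of ?C] inside_Int_outside [of ?C]
    by blast
  then show False
  proof
    assume "F \<subseteq> inside ?C"
    then have "F \<subseteq> inside ?D1 \<union> inside ?D2"
      using split F(2) by blast
    then have "F \<subseteq> inside ?D1 \<or> F \<subseteq> inside ?D2"
      using connectedD [OF F(1) opens(3,4)] split(1) by blast
    moreover have "v2 \<notin> closure (inside ?D1)"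
    proof -
      have "v2 \<notin> inside ?D1"
        using split(2) v(2) inside_no_overlap [of ?C] by blast
      moreover have "v2 \<notin> ?D1"
        using v(2) int by blast
      ultimately show ?thesis
        using closure_inside_subset [of ?D1] closed by (auto simp: closed_Un)
    qed
    moreover have "v1 \<notin> closure (inside ?D2)"
    proof -
      have "v1 \<notin> inside ?D2"
        using split(2) v(1) inside_no_overlap [of ?C] by blast
      moreover have "v1 \<notin> ?D2"
        using v(1) int by blast
      ultimately show ?thesis
        using closure_inside_subset [of ?D2] closed by (auto simp: closed_Un)
    qed
    ultimately show False
      using v(4) by (meson closure_mono insert_subset subsetD)
  next
    assume "F \<subseteq> outside ?C"
    then have "v3 \<in> closure (outside ?C)"
      using v(4) by (meson closure_mono insert_subset subsetD)
    moreover have "closure (outside ?C) \<subseteq> ?C \<union> outside ?C"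
      using closed by (intro closure_outside_subset) (auto simp: closed_Un)
    moreover have "v3 \<in> inside ?C"
      using split(2) v(3) by blast
    ultimately show False
      using inside_no_overlap [of ?C] inside_Int_outside [of ?C] by blast
  qed
qed

lemma theta_curve:
  fixes c1 c2 c3 :: "real \<Rightarrow> complex"
  assumes arcs: "arc c1" "arc c2" "arc c3"
    and ends: "pathstart c1 = a" "pathfinish c1 = b" "pathstart c2 = a" "pathfinish c2 = b"
      "pathstart c3 = a" "pathfinish c3 = b"
    and int: "path_image c1 \<inter> path_image c2 = {a, b}" "path_image c1 \<inter> path_image c3 = {a, b}"
      "path_image c2 \<inter> path_image c3 = {a, b}"
    and F: "connected F" "F \<inter> (path_image c1 \<union> path_image c2 \<union> path_image c3) = {}"
    and v: "v1 \<in> path_image c1 - {a, b}" "v2 \<in> path_image c2 - {a, b}" "v3 \<in> path_image c3 - {a, b}"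
      "{v1, v2, v3} \<subseteq> closure F"
  shows False
proof (cases "path_image c3 \<inter> inside (path_image c1 \<union> path_image c2) = {}")
  case False
  then show False
    using theta_curve_inside assms by metis
next
  case True
  let ?C = "path_image c1 \<union> path_image c2"
  have "simple_path (c1 +++ reversepath c2)"
    using arcs ends int
    by (subst simple_path_join_loop_eq) (auto simp: arc_reversepath)
  moreover have "pathfinish (c1 +++ reversepath c2) = pathstart (c1 +++ reversepath c2)"
    and im: "path_image (c1 +++ reversepath c2) = ?C"
    using ends by (simp_all add: path_image_join)
  ultimately have J: "inside ?C \<noteq> {}" "open (inside ?C)" "connected (inside ?C)"
    "open (outside ?C)"
    using Jordan_inside_outside [of "c1 +++ reversepath c2"] by auto
  then obtain z0 where z0: "z0 \<in> inside ?C"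
    by auto
  \<comment> \<open>Inversion about a point inside the cycle swaps its two sides and so brings the third arc inside.\<close>
  define h where "h z = inverse (z - z0)" for z :: complex
  have contC: "closed ?C" "compact ?C"
    using arcs by (simp_all add: closed_arc_image closed_Un compact_arc_image compact_Un)
  have z0C: "z0 \<notin> ?C" "z0 \<notin> path_image c3"
    using z0 True inside_no_overlap [of ?C] by blast+
  \<comment> \<open>The center of inversion has to avoid \<open>F\<close>. If \<open>F\<close> were
    inside the cycle, its closure could not reach \<open>v3\<close>, because the third arc stays
    outside.\<close>
  have "F \<inter> inside ?C = {}"
  proof (rule ccontr)
    assume "F \<inter> inside ?C \<noteq> {}"
    then have "F \<subseteq> inside ?C"
      using connectedD [OF F(1) J(2,4)] F(2) inside_Un_outside [of ?C] inside_Int_outside [of ?C]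
      by blast
    then have "v3 \<in> closure (inside ?C)"
      using v(4) by (meson closure_mono insert_subset subsetD)
    then have "v3 \<in> ?C \<union> inside ?C"
      using closure_inside_subset [OF contC(1)] by blast
    then show False
      using True v(3) int by blast
  qed
  then have z0F: "z0 \<notin> F"
    using z0 by blast
  \<comment> \<open>As \<open>inverse 0 = 0\<close>, the map is injective on the whole plane, even
    at \<open>z0\<close>; only continuity fails there.\<close>
  have injh: "inj_on h A" for A
    by (auto simp: inj_on_def h_def)
  have conth: "continuous_on A h" if "z0 \<notin> A" for A
    unfolding h_def using that by (intro continuous_intros) auto
  have hi: "h z \<in> h ` A \<longleftrightarrow> z \<in> A" for z A
    using injh [of UNIV] by (simp add: inj_image_mem_iff)
  have arcs': "arc (h \<circ> c)" if "arc c" "z0 \<notin> path_image c" for c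
    using that injh conth [OF that(2)] unfolding arc_def
    by (blast intro: path_continuous_image comp_inj_on)
  have im': "path_image (h \<circ> c) = h ` path_image c" for c
    by (simp add: path_image_compose)
  have hint: "h ` A \<inter> h ` B = h ` (A \<inter> B)" for A B
    using injh [of UNIV] by (simp add: image_Int)
  have hcl: "h w \<in> closure (h ` F)" if "w \<in> closure F" "w \<noteq> z0" for w
  proof -
    have "isCont h w"
      unfolding h_def using that(2) by (intro continuous_intros) auto
    from that(1) obtain s where s: "\<And>n. s n \<in> F" "s \<longlonglongrightarrow> w"
      unfolding closure_sequential by metis
    then have "(\<lambda>n. h (s n)) \<longlonglongrightarrow> h w"
      using \<open>isCont h w\<close> isCont_tendsto_compose by blast
    then show ?thesis
      using s(1) unfolding closure_sequential by (metis imageI)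
  qed
  have vz: "v1 \<noteq> z0" "v2 \<noteq> z0" "v3 \<noteq> z0"
    using v z0C by blast+
  \<comment> \<open>The outside of the image cycle corresponds to the inside of \<open>?C\<close>,
    since \<open>h\<close> is large near \<open>z0\<close>. If \<open>h v3\<close> lay there,
    pulling back would connect \<open>v3\<close> with a point near \<open>z0\<close> off the
    cycle.\<close>
  have meets: "h v3 \<in> inside (h ` ?C)"
  proof (rule ccontr)
    let ?O = "outside (h ` ?C)"
    assume "h v3 \<notin> inside (h ` ?C)"
    moreover have "h v3 \<notin> h ` ?C"
      unfolding hi using v(3) int by blast
    ultimately have hv3: "h v3 \<in> ?O"
      using inside_Un_outside [of "h ` ?C"] by blast
    have comp: "compact (h ` ?C)"
      using contC z0C(1) conth by (intro compact_continuous_image) auto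
    then have O: "open ?O" "connected ?O"
      using connected_outside [of "h ` ?C"] compact_imp_bounded compact_imp_closed
      by (auto intro: open_outside)
    obtain B where B: "\<And>w. w \<in> - ?O \<Longrightarrow> norm w \<le> B"
      using cobounded_outside [OF compact_imp_bounded [OF comp]] bounded_iff by metis
    obtain e where e: "e > 0" "ball z0 e \<subseteq> inside ?C"
      using z0 J(2) open_contains_ball by blast
    \<comment> \<open>The first bound keeps \<open>q\<close> inside the cycle, the second makes the
      norm of \<open>h q\<close> exceed \<open>B\<close>.\<close>
    define r where "r = min (e / 2) (inverse (\<bar>B\<bar> + 1))"
    have r: "r > 0" "r < e" "r \<le> inverse (\<bar>B\<bar> + 1)"
      using e(1) by (auto simp: r_def min_def)
    define q where "q = z0 + of_real r"
    have "q \<in> inside ?C" "q \<noteq> z0"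
      using r e(2) by (auto simp: q_def dist_norm)
    have "norm (h q) = inverse r"
      using r(1) by (simp add: h_def q_def norm_inverse)
    also have "inverse r \<ge> \<bar>B\<bar> + 1"
      using r le_imp_inverse_le [OF r(3,1)] by simp
    finally have "h q \<in> ?O"
      using B [of "h q"] by (metis Compl_iff abs_ge_self add_le_same_cancel1 not_one_le_zero order_trans)
    define k where "k w = inverse w + z0" for w :: complex
    have kh: "k (h z) = z" if "z \<noteq> z0" for z
      using that by (simp add: k_def h_def)
    have hk: "h (k w) = w" for w
      by (simp add: k_def h_def)
    \<comment> \<open>The point 0 stands for infinity and has no preimage off \<open>z0\<close>;
      deleting one point leaves an open connected set of the plane connected.\<close>
    have "connected (?O - {0})"
      using O by (intro connected_open_delete) auto
    then have "connected (k ` (?O - {0}))"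
      unfolding k_def by (intro connected_continuous_image continuous_intros) auto
    moreover have "k ` (?O - {0}) \<inter> ?C = {}"
    proof -
      have "w \<notin> ?O" if "k w \<in> ?C" for w
        using imageI [OF that, of h] outside_no_overlap [of "h ` ?C"] unfolding hk by blast
      then show ?thesis
        by blast
    qed
    moreover have "z \<in> k ` (?O - {0})" if "h z \<in> ?O" "z \<noteq> z0" for z
    proof (rule image_eqI)
      show "z = k (h z)" "h z \<in> ?O - {0}"
        using that kh by (auto simp: h_def)
    qed
    then have "q \<in> k ` (?O - {0})" "v3 \<in> k ` (?O - {0})"
      using \<open>h q \<in> ?O\<close> hv3 \<open>q \<noteq> z0\<close> vz(3) by blast+
    ultimately have "connected_component (- ?C) q v3"
      unfolding connected_component_def by blast
    then have "v3 \<in> inside ?C"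
      using inside_same_component \<open>q \<in> inside ?C\<close> by blast
    then show False
      using True v(3) by blast
  qed
  show False
  proof (rule theta_curve_inside)
    show "arc (h \<circ> c1)" "arc (h \<circ> c2)" "arc (h \<circ> c3)"
      using arcs' arcs z0C by blast+
    show "pathstart (h \<circ> c1) = h a" "pathfinish (h \<circ> c1) = h b" "pathstart (h \<circ> c2) = h a"
      "pathfinish (h \<circ> c2) = h b" "pathstart (h \<circ> c3) = h a" "pathfinish (h \<circ> c3) = h b"
      using ends by (simp_all add: pathstart_compose pathfinish_compose)
    show "path_image (h \<circ> c1) \<inter> path_image (h \<circ> c2) = {h a, h b}"
      "path_image (h \<circ> c1) \<inter> path_image (h \<circ> c3) = {h a, h b}"
      "path_image (h \<circ> c2) \<inter> path_image (h \<circ> c3) = {h a, h b}"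
      unfolding im' hint int by simp_all
    show "connected (h ` F)"
      using F(1) z0F conth connected_continuous_image by blast
    have "h ` F \<inter> h ` (?C \<union> path_image c3) = {}"
      unfolding hint F(2) by simp
    then show "h ` F \<inter> (path_image (h \<circ> c1) \<union> path_image (h \<circ> c2) \<union> path_image (h \<circ> c3)) = {}"
      by (simp add: im' image_Un)
    have hd: "h ` A - {h a, h b} = h ` (A - {a, b})" for A
      using image_set_diff [OF injh [of UNIV], of A "{a, b}"] by simp
    show "h v1 \<in> path_image (h \<circ> c1) - {h a, h b}" "h v2 \<in> path_image (h \<circ> c2) - {h a, h b}"
      "h v3 \<in> path_image (h \<circ> c3) - {h a, h b}"
      unfolding im' hd hi using v by simp_all
    show "{h v1, h v2, h v3} \<subseteq> closure (h ` F)"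
      using hcl v(4) vz by simp
    show "path_image (h \<circ> c3) \<inter> inside (path_image (h \<circ> c1) \<union> path_image (h \<circ> c2)) \<noteq> {}"
      using meets v(3) by (auto simp: im' image_Un)
  qed
qed

section \<open>Outerplanar graphs have no \<open>K\<^sub>2\<^sub>,\<^sub>3\<close> minor\<close>

lemma adj_iff: "(u, v) \<in> adj G \<longleftrightarrow> {u, v} \<in> edges G"
  by (simp add: adj_def)

lemma edge_verts:
  assumes "simple_graph G" "{u, v} \<in> edges G"
  shows "u \<in> verts G" "v \<in> verts G" "u \<noteq> v"
  using assms by (auto simp: simple_graph_def)

fun path_edges :: "'a list \<Rightarrow> 'a set set" where
  "path_edges (u # v # L) = insert {u, v} (path_edges (v # L))"
| "path_edges _ = {}"

lemma path_edges_subset: "e \<in> path_edges L \<Longrightarrow> e \<subseteq> set L"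
  by (induction L rule: path_edges.induct) auto

lemma path_edges_in_edges:
  "successively (\<lambda>u v. {u, v} \<in> edges G) L \<Longrightarrow> path_edges L \<subseteq> edges G"
  by (induction L rule: path_edges.induct) auto

lemma path_edges_snoc_meets: "e \<in> path_edges (M @ [x]) \<Longrightarrow> e \<inter> set M \<noteq> {}"
proof (induction M)
  case (Cons m M)
  then show ?case
    by (cases M) auto
qed auto

text \<open>A nonempty \<open>M\<close> rules out the direct edge between \<open>h\<close> and
  \<open>x\<close>. Hence paths with disjoint interiors share no edge, and their arcs meet only in
  vertices.\<close>

lemma path_edges_meets_interior:
  "M \<noteq> [] \<Longrightarrow> e \<in> path_edges (h # M @ [x]) \<Longrightarrow> e \<inter> set M \<noteq> {}"
  using path_edges_snoc_meets [of e M x] by (cases M) auto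

lemma path_edges_cover: "m \<in> set L \<Longrightarrow> length L \<ge> 2 \<Longrightarrow> \<exists>e\<in>path_edges L. m \<in> e"
proof (induction L rule: path_edges.induct)
  case (1 u v L)
  then show ?case
    by (cases L) auto
qed auto

lemma edge_arc:
  assumes "planar_embedding G p g" "{u, v} \<in> edges G"
  obtains c where "arc c" "pathstart c = p u" "pathfinish c = p v"
    "path_image c = path_image (g {u, v})"
proof -
  have g: "arc (g {u, v})" "{pathstart (g {u, v}), pathfinish (g {u, v})} = {p u, p v}"
    using assms by (auto simp: planar_embedding_def)
  show ?thesis
  proof (cases "pathstart (g {u, v}) = p u")
    case True
    then show ?thesis
      using g that by (metis doubleton_eq_iff)
  next
    case False
    then show ?thesis
      using g that [of "reversepath (g {u, v})"] by (auto simp: doubleton_eq_iff arc_reversepath)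
  qed
qed

lemma planar_embedding_Int:
  "planar_embedding G p g \<Longrightarrow> e \<in> edges G \<Longrightarrow> f \<in> edges G \<Longrightarrow> e \<noteq> f \<Longrightarrow>
    path_image (g e) \<inter> path_image (g f) = p ` (e \<inter> f)"
  by (simp add: planar_embedding_def)

lemma path_arc:
  assumes "planar_embedding G p g"
  shows "successively (\<lambda>u v. {u, v} \<in> edges G) L \<Longrightarrow> distinct L \<Longrightarrow> length L \<ge> 2 \<Longrightarrow>
    \<exists>c. arc c \<and> pathstart c = p (hd L) \<and> pathfinish c = p (last L) \<and>
      path_image c = (\<Union>e\<in>path_edges L. path_image (g e))"
proof (induction L rule: path_edges.induct)
  case (1 u v L)
  obtain c1 where c1: "arc c1" "pathstart c1 = p u" "pathfinish c1 = p v"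
    "path_image c1 = path_image (g {u, v})"
    using edge_arc [OF assms, of u v] "1.prems"(1) by auto
  show ?case
  proof (cases L)
    case Nil
    then show ?thesis
      using c1 by auto
  next
    case (Cons w M)
    then obtain c2 where c2: "arc c2" "pathstart c2 = p v" "pathfinish c2 = p (last L)"
      "path_image c2 = (\<Union>e\<in>path_edges (v # L). path_image (g e))"
      using "1.IH" "1.prems" by auto
    have "path_image c1 \<inter> path_image c2 \<subseteq> {p v}"
    proof -
      have "path_image (g {u, v}) \<inter> path_image (g e) \<subseteq> {p v}" if e: "e \<in> path_edges (v # L)" for e
      proof -
        have "u \<notin> e"
          using path_edges_subset [OF e] "1.prems"(2) by auto
        moreover have "e \<in> edges G" "{u, v} \<in> edges G"
          using e path_edges_in_edges [of G "v # L"] "1.prems"(1) by auto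
        ultimately have "path_image (g {u, v}) \<inter> path_image (g e) = p ` ({u, v} \<inter> e)"
          using planar_embedding_Int [OF assms, of "{u, v}" e] by auto
        then show ?thesis
          using \<open>u \<notin> e\<close> by (simp add: image_subset_iff)
      qed
      then show ?thesis
        unfolding c1 c2 by blast
    qed
    then have "arc (c1 +++ c2)"
      using c1 c2 by (intro arc_join) auto
    then show ?thesis
      using c1 c2 Cons by (intro exI [of _ "c1 +++ c2"]) (simp add: path_image_join)
  qed
qed auto

text \<open>Three internally disjoint paths between \<open>h\<close> and \<open>x\<close> are drawn
  as a theta curve. The outer face avoids it, yet has an inner vertex of each path on its frontier,
  against \<open>theta_curve\<close>.\<close>

lemma outerplanar_no_theta:
  assumes "outerplanar G" "simple_graph G"
    and suc: "\<And>M. M \<in> {M1, M2, M3} \<Longrightarrow> successively (\<lambda>u v. {u, v} \<in> edges G) (h # M @ [x])"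
    and dist: "\<And>M. M \<in> {M1, M2, M3} \<Longrightarrow> distinct (h # M @ [x])"
    and ne: "\<And>M. M \<in> {M1, M2, M3} \<Longrightarrow> M \<noteq> []"
    and disj: "set M1 \<inter> set M2 = {}" "set M1 \<inter> set M3 = {}" "set M2 \<inter> set M3 = {}"
  shows False
proof -
  obtain p g F where emb: "planar_embedding G p g" and F: "F \<in> components (- drawing G p g)"
    and fr: "p ` verts G \<subseteq> frontier F"
    using assms(1) unfolding outerplanar_def by blast
  have "\<exists>c. arc c \<and> pathstart c = p h \<and> pathfinish c = p x \<and>
      path_image c = (\<Union>e\<in>path_edges (h # M @ [x]). path_image (g e))"
    if "M \<in> {M1, M2, M3}" for M
    using path_arc [OF emb suc [OF that] dist [OF that]] by simp
  then obtain c where c: "\<And>M. M \<in> {M1, M2, M3} \<Longrightarrow> arc (c M) \<and> pathstart (c M) = p h \<and>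
      pathfinish (c M) = p x \<and>
      path_image (c M) = (\<Union>e\<in>path_edges (h # M @ [x]). path_image (g e))"
    by metis
  have E: "path_edges (h # M @ [x]) \<subseteq> edges G" if "M \<in> {M1, M2, M3}" for M
    using path_edges_in_edges [OF suc [OF that]] .
  have inj: "inj_on p (verts G)"
    using emb by (simp add: planar_embedding_def)
  have V: "set (h # M @ [x]) \<subseteq> verts G" if "M \<in> {M1, M2, M3}" for M
  proof
    fix m assume "m \<in> set (h # M @ [x])"
    then obtain e where "e \<in> path_edges (h # M @ [x])" "m \<in> e"
      using path_edges_cover [of m "h # M @ [x]"] by auto
    then show "m \<in> verts G"
      using E [OF that] assms(2) unfolding simple_graph_def by blast
  qed
  have int: "path_image (c M) \<inter> path_image (c N) = {p h, p x}"
    if MN: "M \<in> {M1, M2, M3}" "N \<in> {M1, M2, M3}" "set M \<inter> set N = {}" for M N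
  proof
    have "path_image (g e) \<inter> path_image (g f) \<subseteq> {p h, p x}"
      if e: "e \<in> path_edges (h # M @ [x])" and f: "f \<in> path_edges (h # N @ [x])" for e f
    proof -
      have "h \<notin> set M" "x \<notin> set M"
        using dist [OF MN(1)] by auto
      moreover have "e \<inter> set M \<noteq> {}"
        using path_edges_meets_interior e ne [OF MN(1)] by metis
      ultimately have "e \<noteq> f"
        using path_edges_subset [OF f] MN(3) by fastforce
      then have "path_image (g e) \<inter> path_image (g f) = p ` (e \<inter> f)"
        using planar_embedding_Int [OF emb, of e f] E MN(1,2) e f by blast
      moreover have "e \<inter> f \<subseteq> {h, x}"
        using path_edges_subset [OF e] path_edges_subset [OF f] MN(3) by auto
      ultimately show ?thesis
        by blast
    qed
    then show "path_image (c M) \<inter> path_image (c N) \<subseteq> {p h, p x}"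
      using c MN(1,2) by auto
    show "{p h, p x} \<subseteq> path_image (c M) \<inter> path_image (c N)"
      using c MN(1,2) by (metis (no_types, lifting) Int_iff empty_subsetI insert_subset
          pathfinish_in_path_image pathstart_in_path_image)
  qed
  have v: "p (hd M) \<in> path_image (c M) - {p h, p x}" "p (hd M) \<in> closure F"
    if M: "M \<in> {M1, M2, M3}" for M
  proof -
    have m: "hd M \<in> set M"
      using ne [OF M] by simp
    then obtain e where e: "e \<in> path_edges (h # M @ [x])" "hd M \<in> e"
      using path_edges_cover [of "hd M" "h # M @ [x]"] by auto
    then have "e \<in> edges G"
      using E [OF M] by blast
    then have "p ` e \<subseteq> path_image (g e)"
      using emb unfolding planar_embedding_def by blast
    then have "p (hd M) \<in> path_image (c M)"
      using e c [OF M] by blast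
    moreover have "hd M \<in> verts G" "h \<in> verts G" "x \<in> verts G" "hd M \<noteq> h" "hd M \<noteq> x"
      using m V [OF M] dist [OF M] by auto
    ultimately show "p (hd M) \<in> path_image (c M) - {p h, p x}" "p (hd M) \<in> closure F"
      using inj_onD [OF inj] fr by (auto simp: frontier_def)
  qed
  have "path_image (c M) \<subseteq> drawing G p g" if "M \<in> {M1, M2, M3}" for M
    using c [OF that] E [OF that] unfolding drawing_def by blast
  then have Fd: "F \<inter> (path_image (c M1) \<union> path_image (c M2) \<union> path_image (c M3)) = {}"
    using in_components_subset [OF F] by blast
  show False
    by (rule theta_curve [of "c M1" "c M2" "c M3" "p h" "p x" F "p (hd M1)" "p (hd M2)" "p (hd M3)"])
      (use c int disj v Fd in_components_connected [OF F] in auto)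
qed

text \<open>Steps are prepended one at a time; when the new vertex is already on the path, the loop
  before it is cut off.\<close>

lemma rtrancl_simple_path:
  assumes "(u, v) \<in> (adj G \<inter> Y \<times> Y)\<^sup>*" "v \<in> Y"
  shows "\<exists>L. L \<noteq> [] \<and> distinct L \<and> hd L = u \<and> last L = v \<and> set L \<subseteq> Y \<and>
    successively (\<lambda>u v. {u, v} \<in> edges G) L"
  using assms(1)
proof (induction rule: converse_rtrancl_induct)
  case base
  then show ?case
    using assms(2) by (intro exI [of _ "[v]"]) auto
next
  case (step u u')
  then obtain L where L: "L \<noteq> []" "distinct L" "hd L = u'" "last L = v" "set L \<subseteq> Y"
    "successively (\<lambda>u v. {u, v} \<in> edges G) L"
    by blast
  show ?case
  proof (cases "u \<in> set L")
    case True
    then obtain A B where "L = A @ u # B"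
      by (meson split_list)
    then show ?thesis
      using L by (intro exI [of _ "u # B"]) (auto simp: successively_append_iff)
  next
    case False
    then show ?thesis
      using L step(1) by (intro exI [of _ "u # L"]) (auto simp: successively_Cons adj_iff)
  qed
qed

text \<open>A \<open>K\<^sub>2\<^sub>,\<^sub>3\<close> minor whose branch sets are singletons except for \<open>Y\<close>. It contains a theta: join
  \<open>w\<^sub>1\<close> to \<open>w\<^sub>2\<close> by a path through \<open>Y\<close> and follow a path from \<open>w\<^sub>3\<close> until it hits the first path.\<close>

lemma outerplanar_no_K23_minor:
  assumes G: "outerplanar G" "simple_graph G"
    and xw: "{x, w1} \<in> edges G" "{x, w2} \<in> edges G" "{x, w3} \<in> edges G"
    and w: "w1 \<noteq> w2" "w1 \<noteq> w3" "w2 \<noteq> w3" "w1 \<notin> Y" "w2 \<notin> Y" "w3 \<notin> Y" "x \<notin> Y"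
    and y: "y1 \<in> Y" "y2 \<in> Y" "y3 \<in> Y" "{w1, y1} \<in> edges G" "{w2, y2} \<in> edges G" "{w3, y3} \<in> edges G"
    and conn: "\<And>u v. u \<in> Y \<Longrightarrow> v \<in> Y \<Longrightarrow> (u, v) \<in> (adj G \<inter> Y \<times> Y)\<^sup>*"
  shows False
proof -
  let ?suc = "successively (\<lambda>u v. {u, v} \<in> edges G)"
  obtain P where P: "P \<noteq> []" "distinct P" "hd P = y1" "last P = y2" "set P \<subseteq> Y" "?suc P"
    using rtrancl_simple_path [OF conn [OF y(1,2)] y(2)] by blast
  obtain Q where Q: "Q \<noteq> []" "distinct Q" "hd Q = y3" "last Q = y1" "set Q \<subseteq> Y" "?suc Q"
    using rtrancl_simple_path [OF conn [OF y(3,1)] y(1)] by blast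
  \<comment> \<open>\<open>Q\<close> ends in \<open>y1\<close>, the head of \<open>P\<close>. Its
    first vertex \<open>h\<close> on \<open>P\<close> becomes the second branch vertex of the theta,
    opposite \<open>x\<close>. The three legs contain \<open>w1\<close>, \<open>w2\<close>,
    \<open>w3\<close>, so they stay nonempty even if \<open>P1\<close>, \<open>P2\<close> or
    \<open>Q1\<close> is empty.\<close>
  have "\<exists>h\<in>set Q. h \<in> set P"
    using P Q by (metis hd_in_set last_in_set)
  then obtain Q1 h Q2 where q: "Q = Q1 @ h # Q2" "h \<in> set P" "\<forall>u\<in>set Q1. u \<notin> set P"
    using split_list_first_prop [of Q "\<lambda>u. u \<in> set P"] by blast
  then obtain P1 P2 where p: "P = P1 @ h # P2"
    by (meson split_list)
  have rev: "?suc (rev L) \<longleftrightarrow> ?suc L" for L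
    by (simp add: insert_commute)
  have sym: "{w1, x} \<in> edges G" "{w2, x} \<in> edges G" "{w3, x} \<in> edges G"
    "{y1, w1} \<in> edges G" "{y2, w2} \<in> edges G" "{y3, w3} \<in> edges G"
    using xw y by (simp_all add: insert_commute)
  have ne: "w1 \<noteq> x" "w2 \<noteq> x" "w3 \<noteq> x"
    using edge_verts(3) [OF G(2)] xw by blast+
  have "?suc (rev (P1 @ [h]) @ [w1, x])" "?suc (h # P2 @ [w2, x])"
    "?suc (rev (Q1 @ [h]) @ [w3, x])"
  proof -
    have "?suc (P1 @ [h])" "?suc (h # P2)" "?suc (Q1 @ [h])"
      using P(6) Q(6) unfolding p q by (auto simp: successively_append_iff)
    moreover have "hd (P1 @ [h]) = y1" "last (h # P2) = y2" "hd (Q1 @ [h]) = y3"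
      using P Q unfolding p q by (auto simp: hd_append)
    ultimately show "?suc (rev (P1 @ [h]) @ [w1, x])" "?suc (h # P2 @ [w2, x])"
      "?suc (rev (Q1 @ [h]) @ [w3, x])"
      using sym rev successively_append_iff [of _ "h # P2" "[w2, x]"]
      by (auto simp: successively_append_iff [of _ "rev (P1 @ [h])"]
          successively_append_iff [of _ "rev (Q1 @ [h])"] last_rev simp del: rev_append)
  qed
  then have s: "?suc (h # M @ [x])" if "M \<in> {rev P1 @ [w1], P2 @ [w2], rev Q1 @ [w3]}" for M
    using that by auto
  have YP: "set P1 \<subseteq> Y" "set P2 \<subseteq> Y" "set Q1 \<subseteq> Y" "h \<in> Y"
    using P(5) Q(5) unfolding p q by auto
  have d: "distinct (h # M @ [x])" if "M \<in> {rev P1 @ [w1], P2 @ [w2], rev Q1 @ [w3]}" for M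
    using that P(2) Q(2) YP w ne unfolding p q by auto
  have disj: "set P1 \<inter> set P2 = {}" "set P1 \<inter> set Q1 = {}" "set P2 \<inter> set Q1 = {}"
    using P(2) q(3) unfolding p by auto
  show False
    by (rule outerplanar_no_theta [of G "rev P1 @ [w1]" "P2 @ [w2]" "rev Q1 @ [w3]" h x, OF G s d])
      (use disj YP w in auto)
qed

section \<open>Curvature and transport\<close>

lemma gdist_le: "(u, v) \<in> adj G ^^ n \<Longrightarrow> gdist G u v \<le> n"
  unfolding gdist_def by (rule Least_le)

lemma gdist_self [simp]: "gdist G u u = 0"
  using gdist_le [of u u 0 G] by simp

lemma gdist_le_1: "{u, v} \<in> edges G \<Longrightarrow> gdist G u v \<le> 1"
  using gdist_le [of u v 1 G] by (simp add: adj_iff)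

lemma gdist_le_2: "{u, w} \<in> edges G \<Longrightarrow> {w, v} \<in> edges G \<Longrightarrow> gdist G u v \<le> 2"
  using gdist_le [of u v 2 G] by (auto simp: adj_iff numeral_2_eq_2 relcomp_unfold)

lemma adj_relpow_sym: "(u, v) \<in> adj G ^^ n \<Longrightarrow> (v, u) \<in> adj G ^^ n"
proof (induction n arbitrary: v)
  case (Suc n)
  then obtain w where "(u, w) \<in> adj G ^^ n" "(w, v) \<in> adj G"
    by auto
  then show ?case
    using Suc.IH [of w] by (intro relpow_Suc_I2) (auto simp: adj_iff insert_commute)
qed simp

lemma gdist_commute: "gdist G u v = gdist G v u"
  unfolding gdist_def using adj_relpow_sym by metis

lemma mem_nbhd_iff: "u \<in> nbhd G v \<longleftrightarrow> {v, u} \<in> edges G"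
  by (simp add: nbhd_def)

lemma nbhd_sym: "u \<in> nbhd G v \<longleftrightarrow> v \<in> nbhd G u"
  by (simp add: nbhd_def insert_commute)

lemma coupling_support:
  assumes "A \<in> couplings m1 m2"
  shows "set_pmf A \<subseteq> set_pmf m1 \<times> set_pmf m2"
proof -
  have "set_pmf m1 = fst ` set_pmf A" "set_pmf m2 = snd ` set_pmf A"
    using assms unfolding couplings_def by (metis (mono_tags, lifting) mem_Collect_eq set_map_pmf)+
  then show ?thesis
    by (simp add: subset_fst_snd)
qed

lemma nn_integral_gdist:
  assumes "finite (set_pmf A)"
  shows "(\<integral>\<^sup>+ (u, v). of_nat (gdist G u v) \<partial>measure_pmf A) =
    ennreal (measure_pmf.expectation A (\<lambda>(u, v). real (gdist G u v)))"
proof -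
  have "(\<integral>\<^sup>+ (u, v). of_nat (gdist G u v) \<partial>measure_pmf A) =
      (\<integral>\<^sup>+ z. ennreal (case z of (u, v) \<Rightarrow> real (gdist G u v)) \<partial>measure_pmf A)"
    by (intro nn_integral_cong) (auto simp: ennreal_of_nat_eq_real_of_nat)
  also have "\<dots> = ennreal (measure_pmf.expectation A (\<lambda>(u, v). real (gdist G u v)))"
    by (intro nn_integral_eq_integral integrable_measure_pmf_finite assms) auto
  finally show ?thesis .
qed

text \<open>\<open>enn2real\<close> sends \<top> to 0, so a lower bound in \<open>ennreal\<close>
  passes to the reals only below \<top>. The independent coupling provides a finite cost.\<close>

lemma wasserstein_finite:
  assumes "finite (set_pmf m1)" "finite (set_pmf m2)"
  shows "wasserstein G m1 m2 < \<top>"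
proof -
  have "pair_pmf m1 m2 \<in> couplings m1 m2"
    by (simp add: couplings_def map_fst_pair_pmf map_snd_pair_pmf)
  then have "wasserstein G m1 m2 \<le> (\<integral>\<^sup>+ (u, v). of_nat (gdist G u v) \<partial>measure_pmf (pair_pmf m1 m2))"
    unfolding wasserstein_def by (rule INF_lower)
  also have "\<dots> < \<top>"
    using assms by (subst nn_integral_gdist) auto
  finally show ?thesis .
qed

text \<open>The easy half of Kantorovich duality, with separate potentials on the two supports.\<close>

lemma wasserstein_ge:
  assumes fin: "finite (set_pmf m1)" "finite (set_pmf m2)"
    and pot: "\<And>u v. u \<in> set_pmf m1 \<Longrightarrow> v \<in> set_pmf m2 \<Longrightarrow> \<phi> v - \<psi> u \<le> real (gdist G u v)"
  shows "measure_pmf.expectation m2 \<phi> - measure_pmf.expectation m1 \<psi>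
    \<le> enn2real (wasserstein G m1 m2)"
proof -
  let ?c = "measure_pmf.expectation m2 \<phi> - measure_pmf.expectation m1 \<psi>"
  have "ennreal ?c \<le> wasserstein G m1 m2"
    unfolding wasserstein_def
  proof (rule INF_greatest)
    fix A assume A: "A \<in> couplings m1 m2"
    have finA: "finite (set_pmf A)"
      using coupling_support [OF A] fin finite_subset by blast
    have "?c = measure_pmf.expectation (map_pmf snd A) \<phi> - measure_pmf.expectation (map_pmf fst A) \<psi>"
      using A by (simp add: couplings_def)
    also have "\<dots> = measure_pmf.expectation A (\<lambda>z. \<phi> (snd z) - \<psi> (fst z))"
      by (simp add: integrable_measure_pmf_finite finA)
    also have "\<dots> \<le> measure_pmf.expectation A (\<lambda>(u, v). real (gdist G u v))"
      using coupling_support [OF A] pot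
      by (intro integral_mono_AE integrable_measure_pmf_finite finA) (auto simp: AE_measure_pmf_iff)
    finally show "ennreal ?c \<le> (\<integral>\<^sup>+ (u, v). of_nat (gdist G u v) \<partial>measure_pmf A)"
      unfolding nn_integral_gdist [OF finA] by (rule ennreal_leI)
  qed
  then show ?thesis
    using enn2real_mono [of "ennreal ?c"] wasserstein_finite [OF fin]
    by (cases "?c \<ge> 0") (auto intro: order_trans [OF _ enn2real_nonneg])
qed

lemma wasserstein_le:
  assumes "A \<in> couplings m1 m2" "finite (set_pmf A)"
  shows "enn2real (wasserstein G m1 m2) \<le>
    measure_pmf.expectation A (\<lambda>(u, v). real (gdist G u v))"
proof -
  have "wasserstein G m1 m2 \<le> (\<integral>\<^sup>+ (u, v). of_nat (gdist G u v) \<partial>measure_pmf A)"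
    unfolding wasserstein_def by (rule INF_lower) (rule assms)
  then have "wasserstein G m1 m2 \<le> ennreal (measure_pmf.expectation A (\<lambda>(u, v). real (gdist G u v)))"
    unfolding nn_integral_gdist [OF assms(2)] .
  then have "enn2real (wasserstein G m1 m2) \<le>
      enn2real (ennreal (measure_pmf.expectation A (\<lambda>(u, v). real (gdist G u v))))"
    by (intro enn2real_mono) auto
  also have "\<dots> = measure_pmf.expectation A (\<lambda>(u, v). real (gdist G u v))"
    by (intro enn2real_ennreal integral_nonneg_AE) auto
  finally show ?thesis .
qed

text \<open>The limit is the supremum; it is what gives the \<open>Lim\<close> in
  \<open>lly_curvature\<close> its meaning.\<close>

lemma incseq_tendsto_at_left:
  fixes K :: "real \<Rightarrow> real"
  assumes mono: "\<And>a b. 0 \<le> a \<Longrightarrow> a \<le> b \<Longrightarrow> b < 1 \<Longrightarrow> K a \<le> K b"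
    and bdd: "\<And>a. 0 \<le> a \<Longrightarrow> a < 1 \<Longrightarrow> K a \<le> c"
  obtains L where "(K \<longlongrightarrow> L) (at_left 1)" "\<And>a. 0 \<le> a \<Longrightarrow> a < 1 \<Longrightarrow> K a \<le> L"
proof
  let ?L = "SUP a\<in>{0..<1}. K a"
  have bd: "bdd_above (K ` {0..<1})"
    using bdd by (auto intro!: bdd_aboveI [of _ c])
  show up: "K a \<le> ?L" if "0 \<le> a" "a < 1" for a
    using that bd by (intro cSUP_upper) auto
  show "(K \<longlongrightarrow> ?L) (at_left 1)"
  proof (rule increasing_tendsto)
    show "\<forall>\<^sub>F a in at_left 1. K a \<le> ?L"
      using up by (intro eventually_at_leftI [of 0]) auto
    fix l assume "l < ?L"
    then obtain a where a: "0 \<le> a" "a < 1" "l < K a"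
      using less_cSUP_iff [OF _ bd] by auto
    then show "\<forall>\<^sub>F b in at_left 1. l < K b"
      using mono [of a] by (intro eventually_at_leftI [of a]) (auto intro: less_le_trans)
  qed
qed

text \<open>\<open>noniso\<close> excludes the one-vertex graph, where \<open>lazy_walk\<close>
  would not be the intended measure; here it follows from the minimum degree.\<close>

locale lly_graph =
  fixes G :: "'a graph"
  assumes simple: "simple_graph G"
    and conn: "connected_graph G"
    and lfin: "locally_finite G"
    and noniso: "v \<in> verts G \<Longrightarrow> nbhd G v \<noteq> {}"
begin

definition avg :: "('a \<Rightarrow> real) \<Rightarrow> 'a \<Rightarrow> real" where
  "avg f v = (\<Sum>u\<in>nbhd G v. f u) / real (vdegree G v)"

lemma nbhd_verts: "nbhd G v \<subseteq> verts G"
  using edge_verts [OF simple] by (auto simp: nbhd_def)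

lemma not_self_nbhd: "v \<notin> nbhd G v"
  using edge_verts(3) [OF simple, of v v] by (auto simp: nbhd_def)

lemma fin_nbhd: "v \<in> verts G \<Longrightarrow> finite (nbhd G v)"
  using lfin by (simp add: locally_finite_def)

lemma vdegree_pos: "v \<in> verts G \<Longrightarrow> vdegree G v > 0"
  using noniso fin_nbhd by (simp add: vdegree_def card_gt_0_iff)

lemma gdist_relpow:
  assumes "u \<in> verts G" "v \<in> verts G"
  shows "(u, v) \<in> adj G ^^ gdist G u v"
proof -
  have "\<exists>n. (u, v) \<in> adj G ^^ n"
    using conn assms by (auto simp: connected_graph_def rtrancl_power)
  then show ?thesis
    unfolding gdist_def by (rule LeastI_ex)
qed

lemma gdist_triangle:
  assumes "u \<in> verts G" "v \<in> verts G" "w \<in> verts G"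
  shows "gdist G u w \<le> gdist G u v + gdist G v w"
  using assms gdist_relpow by (meson gdist_le relpow_trans)

lemma gdist_ge_1:
  assumes "u \<in> verts G" "v \<in> verts G" "u \<noteq> v"
  shows "1 \<le> gdist G u v"
  using gdist_relpow [OF assms(1,2)] assms(3) by (cases "gdist G u v") auto

lemma gdist_ge_2:
  assumes "u \<in> verts G" "v \<in> verts G" "u \<noteq> v" "v \<notin> nbhd G u"
  shows "2 \<le> gdist G u v"
proof -
  have "gdist G u v \<noteq> 1"
    using gdist_relpow [OF assms(1,2)] assms(4) by (auto simp: adj_iff nbhd_def)
  then show ?thesis
    using gdist_ge_1 [OF assms(1-3)] by simp
qed

lemma gdist_ge_3:
  assumes "u \<in> verts G" "v \<in> verts G" "u \<noteq> v" "v \<notin> nbhd G u" "nbhd G u \<inter> nbhd G v = {}"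
  shows "3 \<le> gdist G u v"
proof -
  have "gdist G u v \<noteq> 2"
  proof
    assume "gdist G u v = 2"
    then have "(u, v) \<in> adj G O adj G"
      using gdist_relpow [OF assms(1,2)] by (simp add: numeral_2_eq_2)
    then show False
      using assms(5) by (auto simp: adj_iff nbhd_def insert_commute)
  qed
  then show ?thesis
    using gdist_ge_2 [OF assms(1-4)] by simp
qed

lemma gdist_nbhd: "u \<in> nbhd G v \<Longrightarrow> gdist G v u = 1"
  using gdist_le_1 [of v u G] gdist_ge_1 [of v u] edge_verts [OF simple, of v u]
  by (auto simp: nbhd_def intro: antisym)

section \<open>Lazy walks, mixtures of idleness, and existence of the curvature limit\<close>

lemma pmf_lw:
  assumes "v \<in> verts G" "0 \<le> \<alpha>" "\<alpha> \<le> 1"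
  shows "pmf (lazy_walk G \<alpha> v) u =
    (if u = v then \<alpha> else if u \<in> nbhd G v then (1 - \<alpha>) / real (vdegree G v) else 0)"
  using pmf_lazy_walk [OF simple fin_nbhd noniso] assms by blast

lemma set_lazy_walk:
  assumes "v \<in> verts G" "0 \<le> \<alpha>" "\<alpha> \<le> 1"
  shows "set_pmf (lazy_walk G \<alpha> v) \<subseteq> insert v (nbhd G v)"
  using pmf_lw [OF assms] by (auto simp: set_pmf_eq split: if_splits)

lemma finite_lazy_walk:
  assumes "v \<in> verts G" "0 \<le> \<alpha>" "\<alpha> \<le> 1"
  shows "finite (set_pmf (lazy_walk G \<alpha> v))"
  using set_lazy_walk [OF assms] fin_nbhd [OF assms(1)] finite_subset by blast

lemma expectation_lazy_walk:
  assumes "v \<in> verts G" "0 \<le> \<alpha>" "\<alpha> \<le> 1"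
  shows "measure_pmf.expectation (lazy_walk G \<alpha> v) f = \<alpha> * f v + (1 - \<alpha>) * avg f v"
proof -
  have "measure_pmf.expectation (lazy_walk G \<alpha> v) f =
      (\<Sum>u\<in>insert v (nbhd G v). f u * pmf (lazy_walk G \<alpha> v) u)"
    using set_lazy_walk [OF assms] fin_nbhd [OF assms(1)] by (intro integral_measure_pmf_real) auto
  also have "\<dots> = \<alpha> * f v + (\<Sum>u\<in>nbhd G v. f u * pmf (lazy_walk G \<alpha> v) u)"
    using fin_nbhd [OF assms(1)] not_self_nbhd by (simp add: pmf_lw [OF assms])
  also have "(\<Sum>u\<in>nbhd G v. f u * pmf (lazy_walk G \<alpha> v) u) =
      (\<Sum>u\<in>nbhd G v. f u * ((1 - \<alpha>) / real (vdegree G v)))"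
    using not_self_nbhd by (intro sum.cong) (auto simp: pmf_lw [OF assms])
  also have "\<dots> = (1 - \<alpha>) * avg f v"
    by (simp only: avg_def sum_distrib_right [symmetric]) simp
  finally show ?thesis .
qed

lemma lazy_walk_mixture:
  assumes "v \<in> verts G" "0 \<le> \<alpha>" "\<alpha> \<le> 1" "0 \<le> t" "t \<le> 1"
  shows "lazy_walk G (1 - t * (1 - \<alpha>)) v =
    bind_pmf (bernoulli_pmf t) (\<lambda>b. if b then lazy_walk G \<alpha> v else return_pmf v)"
proof (rule pmf_eqI)
  fix u
  have "t * (1 - \<alpha>) \<le> 1 * 1"
    using assms by (intro mult_mono) auto
  then have "0 \<le> 1 - t * (1 - \<alpha>)" "1 - t * (1 - \<alpha>) \<le> 1"
    using assms by auto
  then show "pmf (lazy_walk G (1 - t * (1 - \<alpha>)) v) u =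
      pmf (bind_pmf (bernoulli_pmf t) (\<lambda>b. if b then lazy_walk G \<alpha> v else return_pmf v)) u"
    using assms by (auto simp: pmf_bind pmf_lw indicator_def algebra_simps)
qed

abbreviation lw_dist :: "real \<Rightarrow> 'a \<Rightarrow> 'a \<Rightarrow> real" where
  "lw_dist \<alpha> x y \<equiv> enn2real (wasserstein G (lazy_walk G \<alpha> x) (lazy_walk G \<alpha> y))"

text \<open>A coupling of the \<alpha>-lazy walks, mixed with the point mass at
  \<open>(x, y)\<close>, couples the lazier walks at the corresponding mixture of costs.\<close>

lemma lw_dist_mixture:
  assumes xy: "x \<in> verts G" "y \<in> verts G" and \<alpha>: "0 \<le> \<alpha>" "\<alpha> \<le> 1" and t: "0 < t" "t \<le> 1"
  shows "lw_dist (1 - t * (1 - \<alpha>)) x y \<le> t * lw_dist \<alpha> x y + (1 - t) * real (gdist G x y)"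
proof -
  let ?d = "real (gdist G x y)"
  let ?m = "\<lambda>v. lazy_walk G \<alpha> v" and ?m' = "\<lambda>v. lazy_walk G (1 - t * (1 - \<alpha>)) v"
  let ?E = "\<lambda>A. measure_pmf.expectation A (\<lambda>(u, v). real (gdist G u v))"
  \<comment> \<open>The mixture inequality solved for the cost of the given coupling:
    \<open>c\<close> is below the cost of every coupling, so no optimal one has to exist.\<close>
  define c where "c = (lw_dist (1 - t * (1 - \<alpha>)) x y - (1 - t) * ?d) / t"
  have fin: "finite (set_pmf (?m x))" "finite (set_pmf (?m y))"
    using finite_lazy_walk xy \<alpha> by auto
  have "ennreal c \<le> wasserstein G (?m x) (?m y)"
    unfolding wasserstein_def
  proof (rule INF_greatest)
    fix A assume A: "A \<in> couplings (?m x) (?m y)"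
    have finA: "finite (set_pmf A)"
      using coupling_support [OF A] fin finite_subset by blast
    define B where "B = bind_pmf (bernoulli_pmf t) (\<lambda>b. if b then A else return_pmf (x, y))"
    have "map_pmf fst B = bind_pmf (bernoulli_pmf t) (\<lambda>b. if b then map_pmf fst A else return_pmf x)"
      "map_pmf snd B = bind_pmf (bernoulli_pmf t) (\<lambda>b. if b then map_pmf snd A else return_pmf y)"
      by (auto simp: B_def map_bind_pmf intro!: bind_pmf_cong)
    then have B: "B \<in> couplings (?m' x) (?m' y)"
      using A xy \<alpha> t by (simp add: couplings_def lazy_walk_mixture cong: if_cong)
    have "set_pmf B \<subseteq> insert (x, y) (set_pmf A)"
      by (auto simp: B_def split: if_splits)
    then have finB: "finite (set_pmf B)"
      using finA finite_subset by blast
    have "?E B = (\<Sum>z\<in>insert (x, y) (set_pmf A). (case z of (u, v) \<Rightarrow> real (gdist G u v)) * pmf B z)"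
      using finA \<open>set_pmf B \<subseteq> _\<close> by (intro integral_measure_pmf_real) auto
    also have "\<dots> = (\<Sum>z\<in>insert (x, y) (set_pmf A). t * ((case z of (u, v) \<Rightarrow> real (gdist G u v)) * pmf A z)
        + (1 - t) * ((case z of (u, v) \<Rightarrow> real (gdist G u v)) * pmf (return_pmf (x, y)) z))"
      using t by (intro sum.cong) (auto simp: B_def pmf_bind algebra_simps)
    also have "\<dots> = t * ?E A + (1 - t) * ?E (return_pmf (x, y))"
      unfolding sum.distrib sum_distrib_left [symmetric]
      using finA by (subst (1 2) integral_measure_pmf_real [of "insert (x, y) (set_pmf A)"]) auto
    also have "?E (return_pmf (x, y)) = ?d"
      by simp
    finally have "lw_dist (1 - t * (1 - \<alpha>)) x y \<le> t * ?E A + (1 - t) * ?d"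
      using wasserstein_le [OF B finB, of G] by simp
    then have "c \<le> ?E A"
      using t by (simp add: c_def field_simps)
    then show "ennreal c \<le> (\<integral>\<^sup>+ (u, v). of_nat (gdist G u v) \<partial>measure_pmf A)"
      unfolding nn_integral_gdist [OF finA] by (rule ennreal_leI)
  qed
  then have "c \<le> lw_dist \<alpha> x y"
    using enn2real_mono [of "ennreal c"] wasserstein_finite [OF fin]
    by (cases "c \<ge> 0") (auto intro: order_trans [OF _ enn2real_nonneg])
  then show ?thesis
    using t by (simp add: c_def field_simps)
qed

text \<open>Idleness \<open>\<beta> \<ge> \<alpha>\<close> is a mixture of idleness \<open>\<alpha>\<close> and idleness \<open>1\<close>.\<close>

lemma lazy_curvature_mono:
  assumes xy: "x \<in> verts G" "y \<in> verts G" "x \<noteq> y" and ab: "0 \<le> \<alpha>" "\<alpha> \<le> \<beta>" "\<beta> < 1"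
  shows "lazy_curvature G \<alpha> x y / (1 - \<alpha>) \<le> lazy_curvature G \<beta> x y / (1 - \<beta>)"
proof -
  define t where "t = (1 - \<beta>) / (1 - \<alpha>)"
  have t: "0 < t" "t \<le> 1" "t * (1 - \<alpha>) = 1 - \<beta>"
    using ab by (auto simp: t_def)
  then have \<beta>: "\<beta> = 1 - t * (1 - \<alpha>)"
    by simp
  have d: "real (gdist G x y) > 0"
    using gdist_ge_1 [OF xy] by simp
  have "lw_dist \<beta> x y \<le> t * lw_dist \<alpha> x y + (1 - t) * real (gdist G x y)"
    using lw_dist_mixture [OF xy(1,2), of \<alpha> t] ab t(1,2) unfolding \<beta> [symmetric] by simp
  then have "lw_dist \<beta> x y / real (gdist G x y) \<le>
      (t * lw_dist \<alpha> x y + (1 - t) * real (gdist G x y)) / real (gdist G x y)"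
    by (intro divide_right_mono) auto
  also have "\<dots> = t * (lw_dist \<alpha> x y / real (gdist G x y)) + (1 - t)"
    using d by (simp add: add_divide_distrib)
  finally have "t * (1 - lw_dist \<alpha> x y / real (gdist G x y)) \<le> 1 - lw_dist \<beta> x y / real (gdist G x y)"
    by (simp add: algebra_simps)
  then have "t * lazy_curvature G \<alpha> x y / (t * (1 - \<alpha>)) \<le> lazy_curvature G \<beta> x y / (1 - \<beta>)"
    unfolding lazy_curvature_def t(3) using ab by (intro divide_right_mono) auto
  then show ?thesis
    using t(1) by simp
qed

text \<open>Because the potentials are tight at the pair \<open>(x, y)\<close>, the idle mass
  contributes exactly \<alpha> to the normalized cost. After division by \<open>1 - \<alpha>\<close>
  the bound is free of \<alpha>, hence survives the limit.\<close>

lemma lazy_curvature_le: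
  assumes xy: "x \<in> verts G" "y \<in> verts G" "x \<noteq> y" and \<alpha>: "0 \<le> \<alpha>" "\<alpha> < 1"
    and pot: "\<And>u v. u \<in> insert x (nbhd G x) \<Longrightarrow> v \<in> insert y (nbhd G y) \<Longrightarrow>
      \<phi> v - \<psi> u \<le> real (gdist G u v)"
    and tight: "\<phi> y - \<psi> x = real (gdist G x y)"
  shows "lazy_curvature G \<alpha> x y / (1 - \<alpha>) \<le> 1 - (avg \<phi> y - avg \<psi> x) / real (gdist G x y)"
proof -
  let ?d = "real (gdist G x y)"
  have d: "?d > 0"
    using gdist_ge_1 [OF xy] by simp
  have "measure_pmf.expectation (lazy_walk G \<alpha> y) \<phi> - measure_pmf.expectation (lazy_walk G \<alpha> x) \<psi>
      \<le> lw_dist \<alpha> x y"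
    using set_lazy_walk [of _ \<alpha>] xy \<alpha> by (intro wasserstein_ge finite_lazy_walk pot) auto
  then have "\<alpha> * ?d + (1 - \<alpha>) * (avg \<phi> y - avg \<psi> x) \<le> lw_dist \<alpha> x y"
    using xy \<alpha> unfolding tight [symmetric] by (simp add: expectation_lazy_walk algebra_simps)
  then have "(\<alpha> * ?d + (1 - \<alpha>) * (avg \<phi> y - avg \<psi> x)) / ?d \<le> lw_dist \<alpha> x y / ?d"
    by (intro divide_right_mono) auto
  moreover have "(\<alpha> * ?d + (1 - \<alpha>) * (avg \<phi> y - avg \<psi> x)) / ?d =
      \<alpha> + (1 - \<alpha>) * ((avg \<phi> y - avg \<psi> x) / ?d)"
    using d by (simp add: add_divide_distrib)
  ultimately have "lazy_curvature G \<alpha> x y \<le> (1 - \<alpha>) * (1 - (avg \<phi> y - avg \<psi> x) / ?d)"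
    unfolding lazy_curvature_def by (simp add: algebra_simps)
  then show ?thesis
    using \<alpha> by (simp add: pos_divide_le_eq mult.commute)
qed

lemma lly_curvature_limit:
  assumes xy: "x \<in> verts G" "y \<in> verts G" "x \<noteq> y"
  shows "((\<lambda>\<alpha>. lazy_curvature G \<alpha> x y / (1 - \<alpha>)) \<longlongrightarrow> lly_curvature G x y) (at_left 1)"
    and "0 \<le> \<alpha> \<Longrightarrow> \<alpha> < 1 \<Longrightarrow> lazy_curvature G \<alpha> x y / (1 - \<alpha>) \<le> lly_curvature G x y"
proof -
  let ?K = "\<lambda>\<alpha>. lazy_curvature G \<alpha> x y / (1 - \<alpha>)"
  let ?d = "gdist G x y"
  \<comment> \<open>These potentials encode the triangle inequality along \<open>x\<close>,
    \<open>u\<close>, \<open>v\<close>, \<open>y\<close>; they are tight and serve only to bound the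
    quotient from above.\<close>
  let ?\<phi> = "\<lambda>v. real ?d - of_bool (v \<noteq> y)" and ?\<psi> = "\<lambda>u. of_bool (u \<noteq> x) :: real"
  have pot: "?\<phi> v - ?\<psi> u \<le> real (gdist G u v)"
    if uv: "u \<in> insert x (nbhd G x)" "v \<in> insert y (nbhd G y)" for u v
  proof -
    have "u \<in> verts G" "v \<in> verts G"
      using uv xy nbhd_verts by auto
    then have "?d \<le> gdist G x u + gdist G u v + gdist G v y"
      using xy gdist_triangle [of x u y] gdist_triangle [of u v y] by simp
    moreover have "gdist G x u \<le> of_bool (u \<noteq> x)" "gdist G v y \<le> of_bool (v \<noteq> y)"
      using uv gdist_nbhd [of u x] gdist_nbhd [of v y] by (auto simp: gdist_commute [of G v])
    ultimately have "?d \<le> of_bool (u \<noteq> x) + gdist G u v + of_bool (v \<noteq> y)"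
      by linarith
    then have "real ?d \<le> real (of_bool (u \<noteq> x) + gdist G u v + of_bool (v \<noteq> y))"
      by (rule of_nat_mono)
    then show ?thesis
      by simp
  qed
  obtain L where L: "(?K \<longlongrightarrow> L) (at_left 1)" "\<And>a. 0 \<le> a \<Longrightarrow> a < 1 \<Longrightarrow> ?K a \<le> L"
    using incseq_tendsto_at_left [of ?K] lazy_curvature_mono [OF xy]
      lazy_curvature_le [OF xy _ _ pot] by (metis (no_types, lifting) diff_0_right of_bool_eq(1))
  have "lly_curvature G x y = L"
    unfolding lly_curvature_def using L(1) by (intro tendsto_Lim) auto
  then show "(?K \<longlongrightarrow> lly_curvature G x y) (at_left 1)"
    "0 \<le> \<alpha> \<Longrightarrow> \<alpha> < 1 \<Longrightarrow> ?K \<alpha> \<le> lly_curvature G x y"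
    using L by auto
qed

lemma lly_curvature_le:
  assumes xy: "x \<in> verts G" "y \<in> verts G" "x \<noteq> y"
    and pot: "\<And>u v. u \<in> insert x (nbhd G x) \<Longrightarrow> v \<in> insert y (nbhd G y) \<Longrightarrow>
      \<phi> v - \<psi> u \<le> real (gdist G u v)"
    and tight: "\<phi> y - \<psi> x = real (gdist G x y)"
  shows "lly_curvature G x y \<le> 1 - (avg \<phi> y - avg \<psi> x) / real (gdist G x y)"
proof (rule tendsto_upperbound [OF lly_curvature_limit(1) [OF xy]])
  show "\<forall>\<^sub>F \<alpha> in at_left 1. lazy_curvature G \<alpha> x y / (1 - \<alpha>) \<le>
      1 - (avg \<phi> y - avg \<psi> x) / real (gdist G x y)"
    using lazy_curvature_le [OF xy _ _ pot tight] by (intro eventually_at_leftI [of 0]) auto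
qed simp

lemma lly_curvature_pos:
  assumes xy: "x \<in> verts G" "y \<in> verts G" "x \<noteq> y"
    and \<alpha>: "0 \<le> \<alpha>" "\<alpha> < 1" and W: "lw_dist \<alpha> x y < real (gdist G x y)"
  shows "lly_curvature G x y > 0"
proof -
  have "lazy_curvature G \<alpha> x y > 0"
    unfolding lazy_curvature_def using W by (simp add: divide_less_eq)
  then have "lazy_curvature G \<alpha> x y / (1 - \<alpha>) > 0"
    using \<alpha> by simp
  then show ?thesis
    using lly_curvature_limit(2) [OF xy \<alpha>] by linarith
qed

end

section \<open>The degree bound\<close>

lemma sum_of_bool_mem:
  assumes "finite N"
  shows "(\<Sum>u\<in>N. of_bool (u \<in> A) :: real) = real (card (N \<inter> A))"
proof -
  have "(\<Sum>u\<in>N. of_bool (u \<in> A) :: real) = (\<Sum>u\<in>N \<inter> A. 1)"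
    using assms by (intro sum.mono_neutral_cong_right) auto
  then show ?thesis
    by simp
qed

lemma sym_restricted_adj: "sym ((adj G \<inter> Y \<times> Y)\<^sup>*)"
  by (intro sym_rtrancl) (auto simp: sym_def adj_iff insert_commute)

lemma successively_reachable:
  "successively (\<lambda>u v. {u, v} \<in> edges G) M \<Longrightarrow> set M \<subseteq> Y \<Longrightarrow> u \<in> set M \<Longrightarrow>
    (hd M, u) \<in> (adj G \<inter> Y \<times> Y)\<^sup>*"
proof (induction M)
  case (Cons m M)
  show ?case
  proof (cases "u = m")
    case False
    then have u: "u \<in> set M" "M \<noteq> []"
      using Cons.prems by auto
    then have "(hd M, u) \<in> (adj G \<inter> Y \<times> Y)\<^sup>*"
      using Cons by (simp add: successively_Cons)
    moreover have "(m, hd M) \<in> adj G \<inter> Y \<times> Y"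
      using Cons.prems u(2) by (auto simp: successively_Cons adj_iff)
    ultimately show ?thesis
      by (metis converse_rtrancl_into_rtrancl list.sel(1))
  qed simp
qed simp

context lly_graph
begin

definition far :: "'a \<Rightarrow> 'a \<Rightarrow> 'a set" where
  "far x y = nbhd G y - insert x (nbhd G x)"

text \<open>Here \<open>\<psi> \<ge> 1\<close> is forced: a neighbour of \<open>y\<close> is itself
  a target with \<open>\<phi> = 1\<close> at distance 0, and a vertex of \<open>far x y\<close> has
  \<open>\<phi> = 2\<close> at distance 1.\<close>

definition near1 :: "'a \<Rightarrow> 'a \<Rightarrow> 'a set" where
  "near1 x y = {w \<in> nbhd G x - {y}. w \<in> nbhd G y \<or> (\<exists>z\<in>far x y. w \<in> nbhd G z)}"

text \<open>Here \<open>\<psi> \<ge> 0\<close> is forced, by \<open>\<phi> = 1\<close> at distance 1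
  (a common neighbour) or \<open>\<phi> = 2\<close> at distance at most 2 (a vertex of
  \<open>far x y\<close>).\<close>

definition near2 :: "'a \<Rightarrow> 'a \<Rightarrow> 'a set" where
  "near2 x y = {w \<in> nbhd G x - {y} - near1 x y. (\<exists>c\<in>nbhd G x \<inter> nbhd G y. w \<in> nbhd G c) \<or>
    (\<exists>z\<in>far x y. \<exists>q\<in>nbhd G z. q \<noteq> x \<and> w \<in> nbhd G q)}"

text \<open>The test potentials are \<open>\<phi>\<close>, with values \<open>0\<close> at \<open>x\<close>, \<open>1\<close> at \<open>y\<close> and at the common neighbours,
  \<open>2\<close> on \<open>far x y\<close>, and the least \<open>\<psi>\<close> on \<open>N[x]\<close> compatible with it (up to the trivial
  bound \<open>\<psi> \<ge> -1\<close>).\<close>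

lemma edge_curvature_le:
  assumes x: "x \<in> verts G" and y: "y \<in> nbhd G x"
  shows "lly_curvature G x y \<le>
    (2 + 2 * real (card (near1 x y)) + real (card (near2 x y))) / real (vdegree G x) -
    (real (card (nbhd G x \<inter> nbhd G y)) + 2 * real (card (far x y))) / real (vdegree G y)"
proof -
  let ?Z = "far x y" and ?A = "near1 x y" and ?B = "near2 x y"
  let ?\<phi> = "\<lambda>v. if v = x then 0 else if v \<in> ?Z then 2 else 1 :: real"
  let ?\<psi> = "\<lambda>u. if u = x then 0 else if u = y \<or> u \<in> ?A then 1 else if u \<in> ?B then 0 else -1 :: real"
  have yV: "y \<in> verts G" and xy: "x \<noteq> y" and xNy: "x \<in> nbhd G y"
    using nbhd_verts y not_self_nbhd [of x] nbhd_sym [of x G y] by auto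
  have d: "gdist G x y = 1"
    by (rule gdist_nbhd [OF y])
  have pot: "?\<phi> v - ?\<psi> u \<le> real (gdist G u v)"
    if u: "u \<in> insert x (nbhd G x)" and v: "v \<in> insert y (nbhd G y)" for u v
  proof -
    have V: "u \<in> verts G" "v \<in> verts G"
      using u v x yV nbhd_verts by auto
    note D1 = gdist_ge_1 [OF V] and D2 = gdist_ge_2 [OF V] and D3 = gdist_ge_3 [OF V]
    consider "v = x" | "v = y" | "v \<in> nbhd G x \<inter> nbhd G y" "v \<noteq> x" | "v \<in> ?Z"
      using v by (auto simp: far_def)
    then show ?thesis
    proof cases
      case 1
      then show ?thesis
        using D1 by (cases "u = x") auto
    next
      case 2
      then have "y \<notin> ?Z"
        using y by (auto simp: far_def)
      have "1 \<le> gdist G u v" if "u = x"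
        using D1 that 2 xy by simp
      moreover have "1 \<le> gdist G u v" if "u \<in> ?B"
        using D1 that 2 by (auto simp: near2_def)
      moreover have "2 \<le> gdist G u v" if "u \<noteq> x" "u \<noteq> y" "u \<notin> ?A"
        using D2 that 2 u nbhd_sym [of u G y] by (auto simp: near1_def)
      ultimately show ?thesis
        using 2 xy \<open>y \<notin> ?Z\<close> by auto
    next
      case 3
      then have "v \<notin> ?Z" "v \<in> ?A"
        using not_self_nbhd [of y] by (auto simp: far_def near1_def)
      have "1 \<le> gdist G u v" if "u = x"
        using D1 that 3 by simp
      moreover have "1 \<le> gdist G u v" if "u \<in> ?B"
        using D1 that \<open>v \<in> ?A\<close> by (auto simp: near2_def)
      moreover have "2 \<le> gdist G u v" if "u \<noteq> x" "u \<noteq> y" "u \<notin> ?A" "u \<notin> ?B"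
        using D2 that 3 u \<open>v \<in> ?A\<close> nbhd_sym [of u G v] by (auto simp: near2_def)
      ultimately show ?thesis
        using 3 \<open>v \<notin> ?Z\<close> by auto
    next
      case 4
      then have v': "v \<noteq> x" "v \<notin> nbhd G x" "v \<in> nbhd G y"
        by (auto simp: far_def)
      have "2 \<le> gdist G u v" if "u = x"
        using D2 that v' by auto
      moreover have "1 \<le> gdist G u v" if "u \<noteq> x"
        using D1 that v' u by auto
      moreover have "2 \<le> gdist G u v" if "u \<in> ?B"
        using D2 that 4 v' nbhd_sym [of u G v] by (auto simp: near1_def near2_def)
      moreover have "3 \<le> gdist G u v" if "u \<noteq> x" "u \<noteq> y" "u \<notin> ?A" "u \<notin> ?B"
      proof (rule D3)
        show "u \<noteq> v" "v \<notin> nbhd G u"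
          using that u v' 4 nbhd_sym [of u G v] by (auto simp: near1_def)
        have "q \<notin> nbhd G u" if q: "q \<in> nbhd G v" for q
        proof -
          have "q \<noteq> x"
            using q v' nbhd_sym [of q G v] by auto
          then show ?thesis
            using \<open>u \<noteq> x\<close> \<open>u \<noteq> y\<close> \<open>u \<notin> ?A\<close> \<open>u \<notin> ?B\<close> u 4 q nbhd_sym [of q G u]
            by (auto simp: near2_def)
        qed
        then show "nbhd G u \<inter> nbhd G v = {}"
          by auto
      qed
      ultimately show ?thesis
        using 4 v' by auto
    qed
  qed
  have "?\<phi> y - ?\<psi> x = real (gdist G x y)"
    using xy y by (simp add: d far_def)
  from lly_curvature_le [OF x yV xy pot this]
  have le: "lly_curvature G x y \<le> 1 - (avg ?\<phi> y - avg ?\<psi> x)"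
    by (simp add: d)
  have "(\<Sum>u\<in>nbhd G y. ?\<phi> u) =
      (\<Sum>u\<in>nbhd G y. of_bool (u \<in> nbhd G x) + 2 * of_bool (u \<in> ?Z))"
    using not_self_nbhd [of x] by (intro sum.cong) (auto simp: far_def)
  also have "\<dots> = real (card (nbhd G y \<inter> nbhd G x)) + 2 * real (card (nbhd G y \<inter> ?Z))"
    using fin_nbhd [OF yV] by (simp add: sum.distrib sum_distrib_left [symmetric] sum_of_bool_mem del: sum_of_bool_eq)
  also have "nbhd G y \<inter> ?Z = ?Z"
    by (auto simp: far_def)
  finally have \<phi>: "avg ?\<phi> y =
      (real (card (nbhd G x \<inter> nbhd G y)) + 2 * real (card ?Z)) / real (vdegree G y)"
    by (simp add: avg_def Int_commute)
  have A: "y \<notin> ?A" "?A \<subseteq> nbhd G x"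
    by (auto simp: near1_def)
  have B: "y \<notin> ?B" "?B \<subseteq> nbhd G x - ?A"
    by (auto simp: near2_def)
  \<comment> \<open>Relative to the base value -1, the vertex \<open>y\<close> and each vertex of
    \<open>near1\<close> add 2, each vertex of \<open>near2\<close> adds 1. The base value cancels
    the 1 in the curvature.\<close>
  have "(\<Sum>u\<in>nbhd G x. ?\<psi> u) =
      (\<Sum>u\<in>nbhd G x. - 1 + 2 * of_bool (u \<in> {y}) + 2 * of_bool (u \<in> ?A) + of_bool (u \<in> ?B))"
    using not_self_nbhd [of x] A B by (intro sum.cong) auto
  also have "\<dots> = - real (vdegree G x) + 2 * real (card (nbhd G x \<inter> {y})) +
      2 * real (card (nbhd G x \<inter> ?A)) + real (card (nbhd G x \<inter> ?B))"
    by (simp only: sum.distrib sum_distrib_left [symmetric] sum_of_bool_mem [OF fin_nbhd [OF x]]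
        vdegree_def sum_constant mult_minus1_right)
  also have "\<dots> = 2 + 2 * real (card ?A) + real (card ?B) - real (vdegree G x)"
    using y A B by (simp add: Int_absorb1 Int_absorb2 subset_iff)
  finally have \<psi>: "avg ?\<psi> x = (2 + 2 * real (card ?A) + real (card ?B)) / real (vdegree G x) - 1"
    using vdegree_pos [OF x] by (simp add: avg_def field_simps)
  show ?thesis
    using le unfolding \<phi> \<psi> by simp
qed

text \<open>Three elements of \<open>S\<close> would form one side of a K_{2,3} minor, with
  \<open>x\<close> and the connected set \<open>Y\<close> on the other.\<close>

lemma K23_minor_card:
  assumes "outerplanar G"
    and S: "finite S" "S \<subseteq> nbhd G x - Y" "\<And>s. s \<in> S \<Longrightarrow> \<exists>u\<in>Y. s \<in> nbhd G u"
    and "x \<notin> Y"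
    and conn: "\<And>u v. u \<in> Y \<Longrightarrow> v \<in> Y \<Longrightarrow> (u, v) \<in> (adj G \<inter> Y \<times> Y)\<^sup>*"
  shows "card S \<le> 2"
proof (rule ccontr)
  assume "\<not> card S \<le> 2"
  then have "3 \<le> card S"
    by simp
  then obtain T where T: "T \<subseteq> S" "card T = 3"
    using obtain_subset_with_card_n by metis
  then obtain w1 w2 w3 where w: "T = {w1, w2, w3}" "w1 \<noteq> w2" "w2 \<noteq> w3" "w1 \<noteq> w3"
    using card_3_iff by metis
  then obtain y1 y2 y3 where y: "y1 \<in> Y" "y2 \<in> Y" "y3 \<in> Y"
    "w1 \<in> nbhd G y1" "w2 \<in> nbhd G y2" "w3 \<in> nbhd G y3"
    using S(3) T(1) by (metis insert_subset)
  have "{w1, w2, w3} \<subseteq> nbhd G x - Y"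
    using w T(1) S(2) by blast
  then show False
    using outerplanar_no_K23_minor [OF assms(1) simple, of x w1 w2 w3 Y y1 y2 y3] w y conn \<open>x \<notin> Y\<close>
    by (auto simp: nbhd_def insert_commute)
qed

lemma card_common_le_2:
  assumes "outerplanar G" "x \<in> verts G" "a \<noteq> x"
  shows "card (nbhd G x \<inter> nbhd G a) \<le> 2"
  by (rule K23_minor_card [of _ x "{a}"])
    (use assms fin_nbhd not_self_nbhd in \<open>auto intro: finite_subset\<close>)

text \<open>At most two vertices of \<open>nbhd G x - {y}\<close> touch the branch set
  \<open>Y\<close>, and \<open>near1\<close> is among them. Every other vertex of
  \<open>near2\<close> is adjacent to one of \<open>near1\<close>, which shares at most two
  neighbours with \<open>x\<close>. The total is at most 2 + 3 \<open>card (near1 x y)\<close>,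
  hence at most 8.\<close>

lemma near_card_le:
  assumes op: "outerplanar G" and x: "x \<in> verts G" and y: "y \<in> nbhd G x"
  shows "2 * card (near1 x y) + card (near2 x y) \<le> 8"
proof -
  \<comment> \<open>\<open>Q\<close> collects the midpoints outside N[x] of two-step walks from
    \<open>far x y\<close> back to N(x). Adding them keeps the branch set connected through
    \<open>y\<close>.\<close>
  define Q where "Q = {q. q \<notin> insert x (nbhd G x) \<and> (\<exists>z\<in>far x y. q \<in> nbhd G z)}"
  define Y where "Y = insert y (far x y \<union> Q)"
  define S where "S = {w \<in> nbhd G x - {y}. \<exists>u\<in>Y. w \<in> nbhd G u}"
  let ?R = "(adj G \<inter> Y \<times> Y)\<^sup>*"
  have "(y, u) \<in> ?R" if u: "u \<in> Y" for u
  proof -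
    have far: "(y, z) \<in> adj G \<inter> Y \<times> Y" if "z \<in> far x y" for z
      using that by (auto simp: Y_def far_def adj_iff nbhd_def)
    consider "u = y" | "u \<in> far x y" | z where "z \<in> far x y" "u \<in> nbhd G z" "u \<in> Q"
      using u unfolding Y_def Q_def by blast
    then show ?thesis
    proof cases
      case 3
      then have "(z, u) \<in> adj G \<inter> Y \<times> Y"
        by (auto simp: Y_def adj_iff nbhd_def)
      then show ?thesis
        using far [OF 3(1)] by (meson r_into_rtrancl rtrancl.rtrancl_into_rtrancl)
    qed (use far in auto)
  qed
  then have conn: "(u, v) \<in> ?R" if "u \<in> Y" "v \<in> Y" for u v
    using that sym_restricted_adj [of G Y] by (meson rtrancl_trans symE)
  have finx: "finite (nbhd G x)"
    by (rule fin_nbhd [OF x])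
  have "card S \<le> 2"
  proof (rule K23_minor_card [OF op])
    show "finite S"
      using finx by (simp add: S_def)
    show "S \<subseteq> nbhd G x - Y" "x \<notin> Y"
      using y not_self_nbhd [of x] by (auto simp: S_def Y_def Q_def far_def)
  qed (use conn in \<open>auto simp: S_def\<close>)
  let ?A = "near1 x y" and ?B = "near2 x y"
  have finAB: "finite ?A" "finite ?B"
    using finx by (simp_all add: near1_def near2_def)
  have AS: "?A \<subseteq> S"
    by (auto simp: near1_def S_def Y_def)
  have finS: "finite S"
    using finx by (simp add: S_def)
  have "card ?A + card (?B \<inter> S) = card (?A \<union> ?B \<inter> S)"
    using finAB by (subst card_Un_disjoint) (auto simp: near2_def)
  also have "\<dots> \<le> card S"
    using AS finS by (intro card_mono) auto
  finally have 1: "card ?A + card (?B \<inter> S) \<le> 2"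
    using \<open>card S \<le> 2\<close> by simp
  \<comment> \<open>The midpoint of a walk that puts \<open>w\<close> into \<open>near2\<close>
    cannot lie in \<open>Y\<close>, since \<open>w\<close> is outside \<open>S\<close>. So it lies
    in N(x), and then in \<open>near1\<close>.\<close>
  have "?B - S \<subseteq> (\<Union>a\<in>?A. nbhd G x \<inter> nbhd G a)"
  proof
    fix w assume w: "w \<in> ?B - S"
    then have "w \<in> nbhd G x" "w \<noteq> y" "w \<notin> ?A"
      by (auto simp: near2_def)
    moreover have "\<exists>a\<in>?A. w \<in> nbhd G a"
    proof -
      consider c where "c \<in> nbhd G x \<inter> nbhd G y" "w \<in> nbhd G c"
        | z q where "z \<in> far x y" "q \<in> nbhd G z" "q \<noteq> x" "w \<in> nbhd G q"
        using w by (auto simp: near2_def)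
      then show ?thesis
      proof cases
        case 1
        then have "c \<in> ?A"
          using not_self_nbhd [of y] by (auto simp: near1_def)
        then show ?thesis
          using 1 by auto
      next
        case 2
        have "q \<noteq> y"
          using 2 \<open>w \<in> nbhd G x\<close> \<open>w \<noteq> y\<close> \<open>w \<notin> ?A\<close> by (auto simp: near1_def)
        have "q \<notin> Q"
          using w 2 \<open>w \<in> nbhd G x\<close> \<open>w \<noteq> y\<close> by (auto simp: S_def Y_def)
        then have "q \<in> nbhd G x"
          using 2 by (auto simp: Q_def)
        then have "q \<in> ?A"
          using 2 \<open>q \<noteq> y\<close> by (auto simp: near1_def)
        then show ?thesis
          using 2 by auto
      qed
    qed
    ultimately show "w \<in> (\<Union>a\<in>?A. nbhd G x \<inter> nbhd G a)"
      by auto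
  qed
  then have "card (?B - S) \<le> card (\<Union>a\<in>?A. nbhd G x \<inter> nbhd G a)"
    using finAB finx by (intro card_mono) auto
  also have "\<dots> \<le> (\<Sum>a\<in>?A. card (nbhd G x \<inter> nbhd G a))"
    using finAB by (intro card_UN_le) auto
  also have "\<dots> \<le> (\<Sum>a\<in>?A. 2)"
  proof (rule sum_mono)
    fix a assume "a \<in> ?A"
    then have "a \<noteq> x"
      using not_self_nbhd [of x] by (auto simp: near1_def)
    then show "card (nbhd G x \<inter> nbhd G a) \<le> 2"
      by (rule card_common_le_2 [OF op x])
  qed
  finally have 2: "card (?B - S) \<le> 2 * card ?A"
    by simp
  have "card ?B = card (?B \<inter> S) + card (?B - S)"
    using finAB by (metis card_Int_Diff)
  then show ?thesis
    using 1 2 by linarith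
qed

text \<open>With \<open>?t\<close> common neighbours and \<open>?z\<close> far ones, the degree of
  \<open>y\<close> is 1 + \<open>?t\<close> + \<open>?z\<close>, which is at most \<open>?t\<close>
  + 2 \<open>?z\<close> once \<open>?z\<close> is positive. The term of \<open>y\<close> is then at
  least 1 and that of \<open>x\<close> at most (2 + 8) / 10.\<close>

lemma far_empty:
  assumes op: "outerplanar G" and x: "x \<in> verts G" and y: "y \<in> nbhd G x"
    and pos: "lly_curvature G x y > 0" and D: "vdegree G x \<ge> 10"
  shows "far x y = {}"
proof (rule ccontr)
  assume "far x y \<noteq> {}"
  let ?t = "card (nbhd G x \<inter> nbhd G y)" and ?z = "card (far x y)"
  have yV: "y \<in> verts G"
    using nbhd_verts y by auto
  have fin: "finite (far x y)" "finite (nbhd G x)"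
    using fin_nbhd yV x by (auto simp: far_def)
  have "nbhd G y = insert x (nbhd G x \<inter> nbhd G y \<union> far x y)"
    using y nbhd_sym [of y G x] by (auto simp: far_def)
  then have "vdegree G y = Suc (card (nbhd G x \<inter> nbhd G y \<union> far x y))"
    using fin not_self_nbhd [of x] unfolding vdegree_def
    by (subst card_insert_disjoint [symmetric]) (auto simp: far_def)
  also have "card (nbhd G x \<inter> nbhd G y \<union> far x y) = ?t + ?z"
    using fin by (intro card_Un_disjoint) (auto simp: far_def)
  finally have deg: "vdegree G y = 1 + ?t + ?z"
    by simp
  have "?z \<ge> 1"
    using fin \<open>far x y \<noteq> {}\<close> by (simp add: Suc_leI card_gt_0_iff)
  then have "1 \<le> (real ?t + 2 * real ?z) / real (vdegree G y)"
    unfolding deg by simp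
  moreover have "(2 + 2 * real (card (near1 x y)) + real (card (near2 x y))) / real (vdegree G x) \<le> 1"
    using near_card_le [OF op x y] D by simp
  ultimately show False
    using edge_curvature_le [OF x y] pos by linarith
qed

text \<open>Once \<open>far x y\<close> is empty for every neighbour \<open>y\<close> of \<open>x\<close>, the neighbourhood of \<open>x\<close> induces a
  graph with degrees 1 and 2. The end \<open>y\<close> of a longest path in it has one common neighbour
  with \<open>x\<close>, or its component is a triangle; a longer cycle would yield a \<open>K\<^sub>2\<^sub>,\<^sub>3\<close> minor.\<close>

lemma vdegree_le_9:
  assumes op: "outerplanar G" and x: "x \<in> verts G"
    and pos: "\<And>y. y \<in> nbhd G x \<Longrightarrow> lly_curvature G x y > 0"
    and min2: "\<And>y. y \<in> verts G \<Longrightarrow> vdegree G y \<ge> 2"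
  shows "vdegree G x \<le> 9"
proof (rule ccontr)
  assume "\<not> vdegree G x \<le> 9"
  then have D: "vdegree G x \<ge> 10"
    by simp
  let ?N = "nbhd G x"
  have finN: "finite ?N"
    by (rule fin_nbhd [OF x])
  have far: "far x y = {}" if "y \<in> ?N" for y
    by (rule far_empty [OF op x that pos [OF that] D])
  have com2: "card (?N \<inter> nbhd G a) \<le> 2" if "a \<in> ?N" for a
    using card_common_le_2 [OF op x, of a] that not_self_nbhd [of x] by metis
  have near1: "near1 x y = ?N \<inter> nbhd G y" if "y \<in> ?N" for y
    using far [OF that] not_self_nbhd [of y] by (auto simp: near1_def)
  have near2: "w \<in> ?N" "w \<noteq> y" "w \<notin> nbhd G y" "\<exists>c\<in>?N \<inter> nbhd G y. w \<in> nbhd G c"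
    if "w \<in> near2 x y" "y \<in> ?N" for w y
    using that far [OF that(2)] near1 [OF that(2)] by (auto simp: near2_def)
  have deg: "vdegree G y = Suc (card (?N \<inter> nbhd G y))" if "y \<in> ?N" for y
  proof -
    have "nbhd G y = insert x (?N \<inter> nbhd G y)"
      using far [OF that] that nbhd_sym [of y G x] by (auto simp: far_def)
    then show ?thesis
      unfolding vdegree_def using finN not_self_nbhd [of x]
      by (metis Int_iff card_insert_disjoint finite_Int)
  qed
  have deg_ge: "card (?N \<inter> nbhd G y) \<ge> 1" if "y \<in> ?N" for y
    using min2 [of y] deg [OF that] that nbhd_verts by auto
  have curv: "real (card (?N \<inter> nbhd G y)) / (1 + real (card (?N \<inter> nbhd G y))) <
      (2 + 2 * real (card (?N \<inter> nbhd G y)) + real (card (near2 x y))) / 10" if "y \<in> ?N" for y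
  proof -
    let ?c = "2 + 2 * real (card (?N \<inter> nbhd G y)) + real (card (near2 x y))"
    have "?c / real (vdegree G x) \<le> ?c / 10"
      using D by (intro divide_left_mono) auto
    moreover have "lly_curvature G x y \<le> ?c / real (vdegree G x) -
        real (card (?N \<inter> nbhd G y)) / (1 + real (card (?N \<inter> nbhd G y)))"
      using edge_curvature_le [OF x that] far [OF that] near1 [OF that] deg [OF that] by simp
    ultimately show ?thesis
      using pos [OF that] by linarith
  qed
  let ?suc = "successively (\<lambda>u v. {u, v} \<in> edges G)"
  define path where "path L \<longleftrightarrow> L \<noteq> [] \<and> distinct L \<and> set L \<subseteq> ?N \<and> ?suc L" for L
  obtain v where "v \<in> ?N"
    using noniso [OF x] by auto
  then have "path [v]"
    by (simp add: path_def)
  moreover have "\<forall>L. path L \<longrightarrow> length L < Suc (card ?N)"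
    unfolding path_def using finN by (metis card_mono distinct_card le_imp_less_Suc)
  ultimately obtain L where "path L" and max: "\<And>L'. path L' \<Longrightarrow> length L' \<le> length L"
    using ex_has_greatest_nat [of path "[v]" length "Suc (card ?N)"] by blast
  then have L: "L \<noteq> []" "distinct L" "set L \<subseteq> ?N" "?suc L"
    by (simp_all add: path_def)
  then obtain y L' where yL: "L = y # L'"
    by (meson neq_Nil_conv)
  have y: "y \<in> ?N"
    using L yL by simp
  have ynb: "?N \<inter> nbhd G y \<subseteq> set L'"
  proof
    fix w assume w: "w \<in> ?N \<inter> nbhd G y"
    show "w \<in> set L'"
    proof (rule ccontr)
      assume "w \<notin> set L'"
      moreover have "w \<noteq> y"
        using w not_self_nbhd [of y] by auto
      ultimately have "path (w # L)"
        using L w unfolding yL path_def by (auto simp: nbhd_def insert_commute)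
      then show False
        using max by fastforce
    qed
  qed
  let ?t = "card (?N \<inter> nbhd G y)"
  consider "?t = 1" | "?t = 2"
    using com2 [OF y] deg_ge [OF y] by linarith
  then show False
  proof cases
    case 1
    then obtain c where c: "?N \<inter> nbhd G y = {c}"
      using card_1_singletonE by blast
    \<comment> \<open>All these vertices are common neighbours of \<open>x\<close> and
      \<open>c\<close>, which leaves room for only one in \<open>near2\<close>. Then
      \<open>curv\<close> would require 1/2 < (2 + 2 + 1) / 10.\<close>
    have "insert y (near2 x y) \<subseteq> ?N \<inter> nbhd G c"
      using near2 [OF _ y] y c nbhd_sym [of y G c] by auto
    then have "card (insert y (near2 x y)) \<le> 2"
      using card_mono [OF finite_Int [OF disjI1 [OF finN]]] com2 [of c] c
      by (metis IntD1 insertI1 le_trans)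
    moreover have "y \<notin> near2 x y" "finite (near2 x y)"
      using finN by (auto simp: near2_def)
    ultimately have "card (near2 x y) \<le> 1"
      by simp
    then show False
      using curv [OF y] 1 by simp
  next
    case 2
    then obtain v2 L2 where v2: "L' = v2 # L2"
      using ynb by (cases L') auto
    have yv2: "v2 \<in> ?N \<inter> nbhd G y"
      using L unfolding yL v2 by (auto simp: nbhd_def)
    obtain a where a: "a \<in> ?N \<inter> nbhd G y" "a \<noteq> v2" "?N \<inter> nbhd G y = {v2, a}"
    proof -
      have "card (?N \<inter> nbhd G y - {v2}) = 1"
        using 2 yv2 by simp
      then obtain a where "?N \<inter> nbhd G y - {v2} = {a}"
        using card_1_singletonE by blast
      then show ?thesis
        using that [of a] yv2 by blast
    qed
    then have "a \<in> set L2"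
      using ynb unfolding v2 by auto
    then obtain M R where MR: "L2 = M @ a # R"
      by (meson split_list)
    have suc: "?suc (y # v2 # M @ a # R)" "distinct (y # v2 # M @ a # R)"
      "set (y # v2 # M @ a # R) \<subseteq> ?N"
      using L unfolding yL v2 MR by auto
    show False
    proof (cases "M = []")
      case True
      then have "a \<in> nbhd G v2" "v2 \<in> nbhd G a"
        using suc by (auto simp: nbhd_def insert_commute)
      moreover have "y \<in> nbhd G v2" "y \<in> nbhd G a"
        using a yv2 nbhd_sym [of y G v2] nbhd_sym [of y G a] nbhd_sym [of v2 G y] nbhd_sym [of a G y] by blast+
      ultimately have sub: "{y, a} \<subseteq> ?N \<inter> nbhd G v2" "{y, v2} \<subseteq> ?N \<inter> nbhd G a"
        using y a yv2 by auto
      have "card {y, a} = 2" "card {y, v2} = 2"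
        using suc(2) by auto
      moreover have "card (?N \<inter> nbhd G v2) \<le> 2" "card (?N \<inter> nbhd G a) \<le> 2"
        using com2 a(1) yv2 by blast+
      ultimately have eq: "{y, a} = ?N \<inter> nbhd G v2" "{y, v2} = ?N \<inter> nbhd G a"
        using card_seteq [OF _ sub(1)] card_seteq [OF _ sub(2)] finN by simp_all
      have "w \<notin> near2 x y" for w
      proof
        assume w: "w \<in> near2 x y"
        obtain c where "c \<in> {v2, a}" "w \<in> nbhd G c"
          using near2(4) [OF w y] a(3) by blast
        then have "w \<in> {y, a} \<union> {y, v2}"
          using near2(1) [OF w y] eq by blast
        then show False
          using near2(2,3) [OF w y] a(1) yv2 by blast
      qed
      \<comment> \<open>In a triangle component \<open>curv\<close> would require 2/3 < (2 + 4) /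
        10.\<close>
      then have "near2 x y = {}"
        by blast
      then show False
        using curv [OF y] 2 by simp
    next
      case False
      have xN: "x \<notin> ?N"
        by (rule not_self_nbhd)
      have sM: "?suc M" "{v2, hd M} \<in> edges G" "{last M, a} \<in> edges G"
        using suc(1) False by (auto simp: successively_append_iff successively_Cons)
      \<comment> \<open>The hub of this minor is \<open>y\<close>, with \<open>x\<close> as one of
        its three neighbours \<open>v2\<close>, \<open>a\<close>, \<open>x\<close>. The branch set
        \<open>M\<close>, the rest of the cycle, meets \<open>v2\<close> and \<open>a\<close> at its
        ends and \<open>x\<close> everywhere.\<close>
      have conn: "(u, v) \<in> (adj G \<inter> set M \<times> set M)\<^sup>*" if "u \<in> set M" "v \<in> set M" for u v
        using successively_reachable [OF sM(1) subset_refl] that sym_restricted_adj [of G "set M"]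
        by (meson rtrancl_trans symE)
      have "hd M \<in> ?N"
        using suc(3) False by (auto simp: subset_iff)
      moreover have "x \<noteq> v2" "x \<noteq> a" "x \<notin> set M"
        using suc(3) xN by auto
      ultimately show False
        using outerplanar_no_K23_minor [OF op simple, of y v2 a x "set M" "hd M" "last M" "hd M"]
          suc(2) a(1) yv2 y sM(2,3) conn False
        by (auto simp: nbhd_def insert_commute)
    qed
  qed
qed

end

section \<open>Transport plans from overlaps\<close>

lemma coupling_of_matrix:
  fixes B :: "'a \<Rightarrow> 'a \<Rightarrow> real"
  assumes S: "finite S" "set_pmf m1 \<subseteq> S" "set_pmf m2 \<subseteq> S"
    and nonneg: "\<And>u v. u \<in> S \<Longrightarrow> v \<in> S \<Longrightarrow> 0 \<le> B u v"
    and rows: "\<And>u. u \<in> S \<Longrightarrow> (\<Sum>v\<in>S. B u v) = pmf m1 u"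
    and cols: "\<And>v. v \<in> S \<Longrightarrow> (\<Sum>u\<in>S. B u v) = pmf m2 v"
  obtains A where "A \<in> couplings m1 m2" "set_pmf A \<subseteq> S \<times> S"
    "\<And>u v. u \<in> S \<Longrightarrow> v \<in> S \<Longrightarrow> pmf A (u, v) = B u v"
proof -
  define f where "f z = (if z \<in> S \<times> S then B (fst z) (snd z) else 0)" for z
  have f0: "0 \<le> f z" for z
    using nonneg by (auto simp: f_def)
  have "(\<Sum>z\<in>S \<times> S. f z) = (\<Sum>u\<in>S. \<Sum>v\<in>S. B u v)"
    by (simp add: f_def sum.cartesian_product case_prod_beta)
  also have "\<dots> = (\<Sum>u\<in>S. pmf m1 u)"
    using rows by simp
  also have "\<dots> = 1"
    using S by (intro sum_pmf_eq_1) auto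
  finally have "(\<Sum>z\<in>S \<times> S. f z) = 1" .
  moreover have "(\<integral>\<^sup>+z. ennreal (f z) \<partial>count_space UNIV) = (\<Sum>z\<in>S \<times> S. ennreal (f z))"
    using S(1) by (intro nn_integral_count_space') (auto simp: f_def)
  ultimately have "(\<integral>\<^sup>+z. ennreal (f z) \<partial>count_space UNIV) = 1"
    using f0 by (simp add: sum_ennreal)
  then have pmf: "pmf (embed_pmf f) z = f z" for z
    using f0 by (intro pmf_embed_pmf) auto
  let ?A = "embed_pmf f"
  have supp: "set_pmf ?A \<subseteq> S \<times> S"
    by (auto simp: set_pmf_eq pmf f_def)
  have marg: "pmf (map_pmf h ?A) w = (\<Sum>z\<in>{z \<in> S \<times> S. h z = w}. f z)" for h :: "'a \<times> 'a \<Rightarrow> 'a" and w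
  proof -
    have "pmf (map_pmf h ?A) w = measure (measure_pmf ?A) (h -` {w})"
      by (simp add: pmf_map)
    also have "\<dots> = measure (measure_pmf ?A) {z \<in> S \<times> S. h z = w}"
      using supp by (intro measure_prob_cong_0) (auto simp: pmf_eq_0_set_pmf)
    also have "\<dots> = (\<Sum>z\<in>{z \<in> S \<times> S. h z = w}. f z)"
      using S(1) by (subst measure_measure_pmf_finite) (auto simp: pmf)
    finally show ?thesis .
  qed
  have "map_pmf fst ?A = m1"
  proof (rule pmf_eqI)
    fix w
    show "pmf (map_pmf fst ?A) w = pmf m1 w"
    proof (cases "w \<in> S")
      case True
      then have "{z \<in> S \<times> S. fst z = w} = Pair w ` S"
        by auto
      then show ?thesis
        using True rows by (simp add: marg sum.reindex inj_on_def f_def)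
    next
      case False
      then have "{z \<in> S \<times> S. fst z = w} = {}" "pmf m1 w = 0"
        using S by (auto simp: pmf_eq_0_set_pmf)
      then show ?thesis
        by (simp only: marg sum.empty)
    qed
  qed
  moreover have "map_pmf snd ?A = m2"
  proof (rule pmf_eqI)
    fix w
    show "pmf (map_pmf snd ?A) w = pmf m2 w"
    proof (cases "w \<in> S")
      case True
      then have "{z \<in> S \<times> S. snd z = w} = (\<lambda>u. (u, w)) ` S"
        by auto
      then show ?thesis
        using True cols by (simp add: marg sum.reindex inj_on_def f_def)
    next
      case False
      then have "{z \<in> S \<times> S. snd z = w} = {}" "pmf m2 w = 0"
        using S by (auto simp: pmf_eq_0_set_pmf)
      then show ?thesis
        by (simp only: marg sum.empty)
    qed
  qed
  ultimately show ?thesis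
    using that [of ?A] supp by (auto simp: couplings_def pmf f_def)
qed

text \<open>Transport plan: keep the common mass in place, move mass \<open>\<epsilon>\<close> along an edge from \<open>a\<close> to \<open>b\<close>,
  and couple what remains independently. The divisor \<open>\<rho>\<close> below may be zero, in which case
  nothing remains.\<close>

lemma wasserstein_le_overlap:
  assumes S: "finite S" "set_pmf m1 \<subseteq> S" "set_pmf m2 \<subseteq> S"
    and diam: "\<And>u v. u \<in> S \<Longrightarrow> v \<in> S \<Longrightarrow> gdist G u v \<le> 2"
    and ab: "a \<in> S" "b \<in> S" "gdist G a b \<le> 1"
    and \<epsilon>: "0 \<le> \<epsilon>" "\<epsilon> \<le> pmf m1 a - min (pmf m1 a) (pmf m2 a)"
      "\<epsilon> \<le> pmf m2 b - min (pmf m1 b) (pmf m2 b)"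
  shows "enn2real (wasserstein G m1 m2) \<le>
    2 - 2 * (\<Sum>u\<in>S. min (pmf m1 u) (pmf m2 u)) - \<epsilon>"
proof -
  define m where "m u = min (pmf m1 u) (pmf m2 u)" for u
  define p where "p u = pmf m1 u - m u - (if u = a then \<epsilon> else 0)" for u
  define q where "q v = pmf m2 v - m v - (if v = b then \<epsilon> else 0)" for v
  define \<rho> where "\<rho> = 1 - sum m S - \<epsilon>"
  \<comment> \<open>The remainders \<open>p\<close> and \<open>q\<close> both have mass
    \<open>\<rho>\<close>, and their product is normalized by it. At distance at most 2 the cost is
    at most \<open>\<epsilon> + 2 * \<rho>\<close>, which is the claimed bound.\<close>
  define B where "B u v = (if u = v then m u else 0) + (if u = a then if v = b then \<epsilon> else 0 else 0) +
    p u * q v / \<rho>" for u v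
  have sum1: "sum (pmf m1) S = 1" "sum (pmf m2) S = 1"
    using S by (auto intro!: sum_pmf_eq_1)
  have p0: "0 \<le> p u" and q0: "0 \<le> q u" for u
    using \<epsilon> by (auto simp: p_def q_def m_def)
  have sp: "sum p S = \<rho>" and sq: "sum q S = \<rho>"
    using S(1) ab sum1 by (simp_all add: p_def q_def \<rho>_def sum_subtractf)
  then have \<rho>0: "0 \<le> \<rho>"
    using p0 by (metis sum_nonneg)
  have z: "p u = 0" "q u = 0" if "\<rho> = 0" "u \<in> S" for u
    using that sp sq p0 q0 S(1) sum_nonneg_eq_0_iff [of S p] sum_nonneg_eq_0_iff [of S q] by auto
  have B0: "0 \<le> B u v" for u v
    using p0 q0 \<rho>0 \<epsilon>(1) by (auto simp: B_def m_def)
  have rows: "(\<Sum>v\<in>S. B u v) = pmf m1 u" if "u \<in> S" for u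
  proof -
    have "(\<Sum>v\<in>S. B u v) = m u + (if u = a then \<epsilon> else 0) + p u * \<rho> / \<rho>"
      using that S(1) ab
      by (simp add: B_def sum.distrib sum_divide_distrib [symmetric] sum_distrib_left [symmetric] sq)
    also have "p u * \<rho> / \<rho> = p u"
      using z that by (cases "\<rho> = 0") auto
    finally show ?thesis
      by (simp add: p_def)
  qed
  have cols: "(\<Sum>u\<in>S. B u v) = pmf m2 v" if "v \<in> S" for v
  proof -
    have "(\<Sum>u\<in>S. B u v) = m v + (if v = b then \<epsilon> else 0) + \<rho> * q v / \<rho>"
      using that S(1) ab
      by (simp add: B_def sum.distrib sum_divide_distrib [symmetric] sum_distrib_right [symmetric] sp)
    also have "\<rho> * q v / \<rho> = q v"
      using z that by (cases "\<rho> = 0") auto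
    finally show ?thesis
      by (simp add: q_def)
  qed
  obtain A where A: "A \<in> couplings m1 m2" "set_pmf A \<subseteq> S \<times> S"
    "\<And>u v. u \<in> S \<Longrightarrow> v \<in> S \<Longrightarrow> pmf A (u, v) = B u v"
    using coupling_of_matrix [OF S B0 rows cols] by blast
  have "finite (set_pmf A)"
    using A(2) S(1) by (meson finite_SigmaI finite_subset)
  then have "enn2real (wasserstein G m1 m2) \<le>
      measure_pmf.expectation A (\<lambda>(u, v). real (gdist G u v))"
    by (rule wasserstein_le [OF A(1)])
  also have "\<dots> = (\<Sum>z\<in>S \<times> S. (case z of (u, v) \<Rightarrow> real (gdist G u v)) * pmf A z)"
    using A(2) S(1) by (intro integral_measure_pmf_real) auto
  also have "\<dots> = (\<Sum>u\<in>S. \<Sum>v\<in>S. real (gdist G u v) * B u v)"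
    unfolding sum.cartesian_product by (intro sum.cong) (auto simp: A(3))
  also have "\<dots> \<le> (\<Sum>u\<in>S. \<Sum>v\<in>S. (if u = a then if v = b then \<epsilon> else 0 else 0) + 2 * (p u * q v / \<rho>))"
  proof (intro sum_mono)
    fix u v assume uv: "u \<in> S" "v \<in> S"
    let ?d = "real (gdist G u v)" and ?e = "if u = a then if v = b then \<epsilon> else 0 else 0"
    have d2: "?d \<le> 2"
      using diam [OF uv] by simp
    have "?d * (if u = v then m u else 0) = 0"
      by simp
    moreover have "?d * ?e \<le> ?e"
      using ab(3) \<epsilon>(1) by (auto intro: mult_left_le_one_le)
    moreover have "?d * (p u * q v / \<rho>) \<le> 2 * (p u * q v / \<rho>)"
      using d2 p0 q0 \<rho>0 by (intro mult_right_mono) auto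
    ultimately show "?d * B u v \<le> ?e + 2 * (p u * q v / \<rho>)"
      by (simp only: B_def distrib_left)
  qed
  also have "\<dots> = \<epsilon> + 2 * (\<rho> * \<rho> / \<rho>)"
  proof -
    have "(\<Sum>v\<in>S. if u = a then if v = b then \<epsilon> else 0 else 0) = (if u = a then \<epsilon> else 0)" for u
      using S(1) ab by (cases "u = a") auto
    moreover have "(\<Sum>u\<in>S. \<Sum>v\<in>S. 2 * (p u * q v / \<rho>)) = 2 * (\<rho> * \<rho> / \<rho>)"
      by (simp only: sum_distrib_left [symmetric] sum_divide_distrib [symmetric]
          sum_distrib_right [symmetric] sp sq)
    ultimately show ?thesis
      using S(1) ab by (simp add: sum.distrib)
  qed
  also have "\<dots> = 2 - 2 * sum m S - \<epsilon>"
    by (simp add: \<rho>_def)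
  finally show ?thesis
    by (simp add: m_def)
qed

section \<open>The fan graph\<close>

lemma fan_edge_iff:
  "{u, v} \<in> edges (fan_graph n) \<longleftrightarrow> u \<le> n \<and> v \<le> n \<and> u \<noteq> v \<and>
    (u = 0 \<or> v = 0 \<or> v = Suc u \<or> u = Suc v)"
  by (auto simp: fan_graph_def graph_join_def path_graph_def doubleton_eq_iff)

lemma fan_edgeE:
  assumes "e \<in> edges (fan_graph n)"
  obtains a b where "e = {a, b}" "a < b" "b \<le> n" "a = 0 \<or> b = Suc a"
  using assms by (auto simp: fan_graph_def graph_join_def path_graph_def)

lemma fan_verts: "verts (fan_graph n) = {0..n}"
  by (auto simp: fan_graph_def graph_join_def path_graph_def)

lemma fan_simple: "simple_graph (fan_graph n)"
  unfolding simple_graph_def fan_verts by (auto elim!: fan_edgeE)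

text \<open>On a strictly convex curve all chords lie above the curve, so the region below it meets
  no edge and touches every vertex.\<close>

definition parabola :: "nat \<Rightarrow> complex" where
  "parabola i = Complex (real i) ((real i)\<^sup>2)"

text \<open>In terms of \<open>x = Re z\<close>, points of the chord from \<open>a\<close> to \<open>b\<close> lie at height \<open>(x - a) * (b - x)\<close>
  above the parabola.\<close>

lemma chord_iff:
  assumes "a < b"
  shows "z \<in> closed_segment (parabola a) (parabola b) \<longleftrightarrow>
    real a \<le> Re z \<and> Re z \<le> real b \<and> Im z = (Re z)\<^sup>2 + (Re z - real a) * (real b - Re z)"
    (is "?L \<longleftrightarrow> ?R")
proof
  assume ?L
  then obtain t where t: "0 \<le> t" "t \<le> 1" "z = (1 - t) *\<^sub>R parabola a + t *\<^sub>R parabola b"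
    by (auto simp: in_segment)
  then have re: "Re z = a + t * (real b - real a)" and im: "Im z = (1 - t) * (real a)\<^sup>2 + t * (real b)\<^sup>2"
    by (simp_all add: t(3) parabola_def) (simp add: algebra_simps)
  have "0 \<le> t * (real b - real a)" "0 \<le> (1 - t) * (real b - real a)"
    using t assms by simp_all
  then show ?R
    unfolding re im by (simp add: algebra_simps power2_eq_square)
next
  assume R: ?R
  define t where "t = (Re z - a) / (real b - real a)"
  have t: "0 \<le> t" "t \<le> 1" and x: "Re z = a + t * (real b - real a)"
    using R assms by (auto simp: t_def)
  have "Im z = (1 - t) * (real a)\<^sup>2 + t * (real b)\<^sup>2"
    using R unfolding x by (simp add: algebra_simps power2_eq_square)
  then have "z = (1 - t) *\<^sub>R parabola a + t *\<^sub>R parabola b"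
    using x by (simp add: parabola_def complex_eq_iff algebra_simps)
  then show ?L
    using t by (auto simp: in_segment)
qed

lemma chord_ends_iff:
  assumes "a < b" "z \<in> closed_segment (parabola a) (parabola b)"
  shows "Im z = (Re z)\<^sup>2 \<longleftrightarrow> z \<in> {parabola a, parabola b}"
  using assms(2) unfolding chord_iff [OF assms(1)] by (auto simp: parabola_def complex_eq_iff)

text \<open>Two chords over a common interior abscissa are nested or share their left end, since a
  chord not starting at 0 spans one unit only. In either case their heights above the parabola
  differ strictly there.\<close>

lemma chords_noncrossing:
  assumes "a < b" "c < d" "a = 0 \<or> b = Suc a" "c = 0 \<or> d = Suc c" "(a, b) \<noteq> (c, d)"
    and "z \<in> closed_segment (parabola a) (parabola b)" "z \<in> closed_segment (parabola c) (parabola d)"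
  shows "Im z = (Re z)\<^sup>2"
proof -
  have *: False if ab: "a < b" "a = 0 \<or> b = Suc a" and cd: "c = 0 \<or> d = Suc c" "c < d" and ne: "(a, b) \<noteq> (c, d)" "a \<le> c"
    and x: "real a < x" "x < real b" "real c < x" "x < real d"
    and eq: "(x - real a) * (real b - x) = (x - real c) * (real d - x)" for a b c d x
  proof (cases "a = c")
    case True
    then show False
      using x eq ne by simp
  next
    case False
    then have "d = Suc c" "a < c"
      using cd ne by auto
    then have "real a < real c"
      by simp
    have "a = 0"
    proof (rule ccontr)
      assume "a \<noteq> 0"
      then have "b \<le> c"
        using ab \<open>a < c\<close> by simp
      then show False
        using x by simp
    qed
    have "\<not> b \<le> c"
      using x by (meson leD less_trans of_nat_le_iff order.strict_trans1)
    then have "real d \<le> real b"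
      using \<open>d = Suc c\<close> by simp
    then have "(x - real c) * (real d - x) \<le> (x - real c) * (real b - x)"
      using x by (intro mult_left_mono) auto
    also have "\<dots> < (x - real a) * (real b - x)"
      using x \<open>real a < real c\<close> by (intro mult_strict_right_mono) auto
    finally show False
      using eq by simp
  qed
  let ?x = "Re z"
  have z: "real a \<le> ?x" "?x \<le> real b" "real c \<le> ?x" "?x \<le> real d"
    "Im z = ?x\<^sup>2 + (?x - real a) * (real b - ?x)" "Im z = ?x\<^sup>2 + (?x - real c) * (real d - ?x)"
    using assms by (auto simp: chord_iff)
  show ?thesis
  proof (rule ccontr)
    assume "Im z \<noteq> ?x\<^sup>2"
    then have "(?x - real a) * (real b - ?x) \<noteq> 0" "(?x - real c) * (real d - ?x) \<noteq> 0"
      using z(5,6) by auto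
    then have "real a < ?x" "?x < real b" "real c < ?x" "?x < real d"
      using z(1-4) by (auto simp: less_le)
    moreover have "(?x - real a) * (real b - ?x) = (?x - real c) * (real d - ?x)"
      using z(5,6) by simp
    ultimately show False
      using *[of a b c d ?x] *[of c d a b ?x] assms(1-5) by (cases "a \<le> c") auto
  qed
qed

lemma fan_outerplanar: "outerplanar (fan_graph n)"
proof -
  define g where "g e = linepath (parabola (Min e)) (parabola (Max e))" for e
  have inj: "inj parabola"
    by (auto simp: inj_on_def parabola_def)
  have g: "path_image (g {a, b}) = closed_segment (parabola a) (parabola b)" if "a < b" for a b
    using that by (simp add: g_def)
  have on: "Im (parabola k) = (Re (parabola k))\<^sup>2" for k
    by (simp add: parabola_def)
  have emb: "planar_embedding (fan_graph n) parabola g"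
    unfolding planar_embedding_def
  proof (intro conjI ballI impI)
    show "inj_on parabola (verts (fan_graph n))"
      using inj by (rule inj_on_subset) simp
  next
    fix e assume "e \<in> edges (fan_graph n)"
    then obtain a b where e: "e = {a, b}" "a < b" "b \<le> n"
      by (rule fan_edgeE)
    show "arc (g e)"
      using e injD [OF inj, of a b] by (auto simp: g_def intro!: arc_linepath)
    show "{pathstart (g e), pathfinish (g e)} = parabola ` e"
      using e by (simp add: g_def)
    show "path_image (g e) \<inter> parabola ` verts (fan_graph n) = parabola ` e"
      using e chord_ends_iff [OF e(2)] on by (auto simp: g fan_verts)
  next
    fix e f assume "e \<in> edges (fan_graph n)" "f \<in> edges (fan_graph n)" "e \<noteq> f"
    then obtain a b c d where e: "e = {a, b}" "a < b" "a = 0 \<or> b = Suc a"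
      and f: "f = {c, d}" "c < d" "c = 0 \<or> d = Suc c"
      by (metis fan_edgeE)
    have "z \<in> parabola ` e \<inter> parabola ` f" if "z \<in> path_image (g e) \<inter> path_image (g f)" for z
    proof -
      have z: "z \<in> closed_segment (parabola a) (parabola b)"
        "z \<in> closed_segment (parabola c) (parabola d)"
        using that e f by (auto simp: g)
      then have "Im z = (Re z)\<^sup>2"
        using chords_noncrossing e f \<open>e \<noteq> f\<close> by (metis Pair_inject)
      then have "z \<in> {parabola a, parabola b}" "z \<in> {parabola c, parabola d}"
        using chord_ends_iff [OF e(2) z(1)] chord_ends_iff [OF f(2) z(2)] by blast+
      then show ?thesis
        using e f by blast
    qed
    moreover have "parabola ` (e \<inter> f) \<subseteq> path_image (g e) \<inter> path_image (g f)"
      using e f by (auto simp: g)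
    ultimately show "path_image (g e) \<inter> path_image (g f) = parabola ` (e \<inter> f)"
      using image_Int [OF inj, of e f] by blast
  qed
  \<comment> \<open>The region below the parabola is a sheared half plane, hence connected, and lies
    in a single face \<open>F\<close>. It is unbounded and approaches each vertex vertically from
    below.\<close>
  define R where "R = {z. Im z < (Re z)\<^sup>2}"
  define D where "D = drawing (fan_graph n) parabola g"
  have "R = (\<lambda>z. Complex (Re z) (Im z + (Re z)\<^sup>2)) ` {z. Im z < 0}"
  proof (intro equalityI subsetI)
    fix z assume "z \<in> R"
    then show "z \<in> (\<lambda>z. Complex (Re z) (Im z + (Re z)\<^sup>2)) ` {z. Im z < 0}"
      by (intro image_eqI [of _ _ "Complex (Re z) (Im z - (Re z)\<^sup>2)"]) (auto simp: R_def)
  qed (auto simp: R_def)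
  moreover have "connected {z. Im z < 0}"
    using convex_halfspace_Im_lt convex_connected by blast
  moreover have "continuous_on UNIV (\<lambda>z. Complex (Re z) (Im z + (Re z)\<^sup>2))"
    unfolding Complex_eq by (intro continuous_intros)
  ultimately have R: "connected R"
    using connected_continuous_image [OF continuous_on_subset [OF _ subset_UNIV]] by simp
  have "D \<inter> R = {}"
  proof -
    have "Im z \<ge> (Re z)\<^sup>2" if "z \<in> path_image (g e)" "e \<in> edges (fan_graph n)" for z e
      using that(2)
    proof (rule fan_edgeE)
      fix a b assume "e = {a, b}" "a < b"
      then show ?thesis
        using that(1) by (auto simp: g chord_iff)
    qed
    then show ?thesis
      by (fastforce simp: D_def drawing_def R_def on not_less [symmetric])
  qed
  define F where "F = connected_component_set (- D) (- \<i>)"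
  have "- \<i> \<in> R"
    by (simp add: R_def)
  then have RF: "R \<subseteq> F"
    using R \<open>D \<inter> R = {}\<close> unfolding F_def by (intro connected_component_maximal) auto
  have "F \<in> components (- D)"
    using \<open>- \<i> \<in> R\<close> \<open>D \<inter> R = {}\<close> unfolding F_def by (auto simp: components_def)
  moreover have "\<not> bounded F"
  proof
    assume "bounded F"
    then obtain B where B: "\<And>z. z \<in> R \<Longrightarrow> norm z \<le> B"
      using RF by (meson bounded_iff subsetD)
    have "Complex 0 (- (\<bar>B\<bar> + 1)) \<in> R"
      by (simp add: R_def)
    from B [OF this] show False
      by (simp add: cmod_def)
  qed
  moreover have "parabola ` verts (fan_graph n) \<subseteq> frontier F"
  proof
    fix w assume w: "w \<in> parabola ` verts (fan_graph n)"
    then obtain k where k: "w = parabola k"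
      by auto
    have "w \<in> closure R"
      unfolding closure_approachable
    proof (intro allI impI)
      fix r :: real assume "r > 0"
      then show "\<exists>z\<in>R. dist z w < r"
        by (intro bexI [of _ "Complex (real k) ((real k)\<^sup>2 - r / 2)"])
          (auto simp: R_def k parabola_def dist_complex_def cmod_def)
    qed
    then have "w \<in> closure F"
      using RF closure_mono by blast
    moreover have "F \<subseteq> - D"
      unfolding F_def by (rule connected_component_subset)
    then have "w \<notin> F"
      using w by (auto simp: D_def drawing_def)
    ultimately show "w \<in> frontier F"
      using interior_subset by (auto simp: frontier_def)
  qed
  ultimately show ?thesis
    unfolding outerplanar_def using emb D_def by blast
qed

section \<open>Degrees and curvature of the fan\<close>

lemma fan_nbhd:
  "u \<in> nbhd (fan_graph n) v \<longleftrightarrow> u \<le> n \<and> v \<le> n \<and> u \<noteq> v \<and>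
    (u = 0 \<or> v = 0 \<or> v = Suc u \<or> u = Suc v)"
  unfolding mem_nbhd_iff fan_edge_iff by auto

lemma fan_lly_graph:
  assumes "n \<ge> 1"
  shows "lly_graph (fan_graph n)"
proof
  show "simple_graph (fan_graph n)"
    by (rule fan_simple)
  show "connected_graph (fan_graph n)"
    unfolding connected_graph_def fan_verts
  proof (intro conjI ballI)
    fix u v assume uv: "u \<in> {0..n}" "v \<in> {0..n}"
    have "(u, 0) \<in> (adj (fan_graph n))\<^sup>*" "(0, v) \<in> (adj (fan_graph n))\<^sup>*"
      using uv by (cases "u = 0"; cases "v = 0"; auto simp: adj_iff fan_edge_iff)+
    then show "(u, v) \<in> (adj (fan_graph n))\<^sup>*"
      by (rule rtrancl_trans)
  qed simp
  show "locally_finite (fan_graph n)"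
    unfolding locally_finite_def
  proof
    fix v
    show "finite (nbhd (fan_graph n) v)"
      by (rule finite_subset [of _ "{0..n}"]) (auto simp: fan_nbhd)
  qed
  show "nbhd (fan_graph n) v \<noteq> {}" if "v \<in> verts (fan_graph n)" for v
    using that assms fan_nbhd [of 0 n v] fan_nbhd [of 1 n v] by (cases "v = 0") (auto simp: fan_verts)
qed

lemma fan_degree_0: "vdegree (fan_graph n) 0 = n"
proof -
  have "nbhd (fan_graph n) 0 = {1..n}"
    by (auto simp: fan_nbhd)
  then show ?thesis
    by (simp add: vdegree_def)
qed

lemma fan_degree:
  assumes "n \<ge> 2" "1 \<le> i" "i \<le> n"
  shows "vdegree (fan_graph n) i = (if i = 1 \<or> i = n then 2 else 3)"
proof -
  have "nbhd (fan_graph n) i =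
      (if i = 1 then {0, 2} else if i = n then {0, n - 1} else {0, i - 1, i + 1})"
    using assms by (auto simp: fan_nbhd)
  then show ?thesis
    using assms by (auto simp: vdegree_def)
qed

lemma fan_gdist_le_2:
  assumes "u \<le> n" "v \<le> n"
  shows "gdist (fan_graph n) u v \<le> 2"
proof (cases "u = v \<or> u = 0 \<or> v = 0")
  case True
  then have "gdist (fan_graph n) u v \<le> 1"
    using assms gdist_le_1 [of u v "fan_graph n"] by (cases "u = v") (auto simp: fan_edge_iff)
  then show ?thesis
    by simp
next
  case False
  then show ?thesis
    using assms by (intro gdist_le_2 [of u 0]) (auto simp: fan_edge_iff)
qed

interpretation fan: lly_graph "fan_graph 9"
  by (rule fan_lly_graph) simp

lemma fan_pmf:
  assumes "v \<le> 9" "0 \<le> \<alpha>" "\<alpha> \<le> 1"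
  shows "pmf (lazy_walk (fan_graph 9) \<alpha> v) u =
    (if u = v then \<alpha>
     else if u \<le> 9 \<and> (u = 0 \<or> v = 0 \<or> v = Suc u \<or> u = Suc v)
       then (1 - \<alpha>) / (if v = 0 then 9 else if v = 1 \<or> v = 9 then 2 else 3)
     else 0)"
  using assms fan.pmf_lw [of v \<alpha> u] fan_degree_0 [of 9] fan_degree [of 9 v]
  by (auto simp: fan_verts fan_nbhd)

text \<open>The numerical hypotheses of \<open>wasserstein_le_overlap\<close> as one predicate,
  symmetric under exchange of the endpoints. The sum runs over a chosen \<open>T\<close> only:
  omitted overlaps are nonnegative and could just lower the cost.\<close>

definition overlap_cond :: "real \<Rightarrow> nat \<Rightarrow> nat \<Rightarrow> nat \<Rightarrow> nat \<Rightarrow> real \<Rightarrow> nat set \<Rightarrow> bool" where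
  "overlap_cond \<alpha> x y a b \<epsilon> T \<longleftrightarrow>
     (let m1 = pmf (lazy_walk (fan_graph 9) \<alpha> x); m2 = pmf (lazy_walk (fan_graph 9) \<alpha> y) in
      0 \<le> \<alpha> \<and> \<alpha> < 1 \<and> a \<le> 9 \<and> b \<le> 9 \<and> gdist (fan_graph 9) a b \<le> 1 \<and> T \<subseteq> {0..9} \<and>
      0 \<le> \<epsilon> \<and> \<epsilon> \<le> m1 a - min (m1 a) (m2 a) \<and> \<epsilon> \<le> m2 b - min (m1 b) (m2 b) \<and>
      2 - 2 * (\<Sum>u\<in>T. min (m1 u) (m2 u)) - \<epsilon> < real (gdist (fan_graph 9) x y))"

lemma overlap_cond_commute: "overlap_cond \<alpha> x y a b \<epsilon> T \<Longrightarrow> overlap_cond \<alpha> y x b a \<epsilon> T"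
  unfolding overlap_cond_def Let_def
  by (simp add: gdist_commute [of _ x y] gdist_commute [of _ a b] min.commute)

lemma overlap_cond_imp_pos:
  assumes "overlap_cond \<alpha> x y a b \<epsilon> T" and xy: "x \<le> 9" "y \<le> 9" "x \<noteq> y"
  shows "lly_curvature (fan_graph 9) x y > 0"
proof -
  let ?m1 = "lazy_walk (fan_graph 9) \<alpha> x" and ?m2 = "lazy_walk (fan_graph 9) \<alpha> y"
  have c: "0 \<le> \<alpha>" "\<alpha> < 1" "a \<le> 9" "b \<le> 9" "gdist (fan_graph 9) a b \<le> 1" "T \<subseteq> {0..9}" "0 \<le> \<epsilon>"
    "\<epsilon> \<le> pmf ?m1 a - min (pmf ?m1 a) (pmf ?m2 a)" "\<epsilon> \<le> pmf ?m2 b - min (pmf ?m1 b) (pmf ?m2 b)"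
    "2 - 2 * (\<Sum>u\<in>T. min (pmf ?m1 u) (pmf ?m2 u)) - \<epsilon> < real (gdist (fan_graph 9) x y)"
    using assms(1) unfolding overlap_cond_def Let_def by blast+
  have "set_pmf (lazy_walk (fan_graph 9) \<alpha> v) \<subseteq> {0..9}" if "v \<le> 9" for v
    using fan.set_lazy_walk [of v \<alpha>] that c(1,2) by (auto simp: fan_verts fan_nbhd)
  then have "enn2real (wasserstein (fan_graph 9) ?m1 ?m2) \<le>
      2 - 2 * (\<Sum>u\<in>{0..9}. min (pmf ?m1 u) (pmf ?m2 u)) - \<epsilon>"
    using c xy by (intro wasserstein_le_overlap [where a = a and b = b]) (auto intro: fan_gdist_le_2)
  also have "(\<Sum>u\<in>{0..9}. min (pmf ?m1 u) (pmf ?m2 u)) \<ge> (\<Sum>u\<in>T. min (pmf ?m1 u) (pmf ?m2 u))"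
    using c(6) by (intro sum_mono2) auto
  then have "2 - 2 * (\<Sum>u\<in>{0..9}. min (pmf ?m1 u) (pmf ?m2 u)) - \<epsilon> < real (gdist (fan_graph 9) x y)"
    using c(10) by linarith
  finally show ?thesis
    using c(1,2) xy by (intro fan.lly_curvature_pos) (auto simp: fan_verts)
qed

lemma fan_overlap_cond:
  assumes "x < y" "y \<le> 9"
  shows "\<exists>\<alpha> a b \<epsilon> T. overlap_cond \<alpha> x y a b \<epsilon> T"
proof -
  have V: "x \<in> verts (fan_graph 9)" "y \<in> verts (fan_graph 9)" "x \<noteq> y"
    using assms by (auto simp: fan_verts)
  have adj: "gdist (fan_graph 9) a b \<le> 1" if "b = Suc a \<or> a = Suc b" "a \<le> 9" "b \<le> 9" for a b
    using that by (intro gdist_le_1) (auto simp: fan_edge_iff)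
  have d1: "1 \<le> gdist (fan_graph 9) x y"
    using fan.gdist_ge_1 [OF V] .
  \<comment> \<open>When \<open>x = 0\<close>, idleness \<open>1 / (d\<^sub>y + 1)\<close> makes the walk from \<open>y\<close> uniform on \<open>N[y]\<close>.\<close>
  consider "x = 0" "y = 1" | "x = 0" "y = 9" | "x = 0" "2 \<le> y" "y \<le> 6" | "x = 0" "7 \<le> y" "y \<le> 8"
    | "1 \<le> x" "y = Suc x" | "1 \<le> x" "y > Suc x"
    using assms by linarith
  then show ?thesis
  proof cases
    case 1
    \<comment> \<open>The overlap 1/3 + 2/27 + 2/27 alone gives cost 28/27. Sending the mass 2/27 at
      3 to its neighbour 2 in one step lowers it to 26/27.\<close>
    then have "overlap_cond (1/3) x y 3 2 (2/27) {0, 1, 2}"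
      using d1 adj by (simp add: overlap_cond_def fan_pmf)
    then show ?thesis
      by blast
  next
    case 2
    then have "overlap_cond (1/3) x y 7 8 (2/27) {0, 8, 9}"
      using d1 adj by (simp add: overlap_cond_def fan_pmf)
    then show ?thesis
      by blast
  next
    case 3
    then have "y \<in> {2, 3, 4, 5, 6}"
      by auto
    \<comment> \<open>The overlap 1/4 + 3/12 alone gives cost exactly 1; the short move of mass 1/12
      from \<open>y + 2\<close> makes it 11/12.\<close>
    then have "overlap_cond (1/4) x y (y + 2) (y + 1) (1/12) {0, y - 1, y, y + 1}"
      using d1 adj 3(1) by (elim insertE emptyE) (simp_all add: overlap_cond_def fan_pmf)
    then show ?thesis
      by blast
  next
    case 4
    then have "y \<in> {7, 8}"
      by auto
    \<comment> \<open>Mirror image of the previous plan: for \<open>y = 8\<close> the vertex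
      \<open>y + 2\<close> would be off the path.\<close>
    then have "overlap_cond (1/4) x y (y - 2) (y - 1) (1/12) {0, y - 1, y, y + 1}"
      using d1 adj 4(1) by (elim insertE emptyE) (simp_all add: overlap_cond_def fan_pmf)
    then show ?thesis
      by blast
  next
    case 5
    \<comment> \<open>Both walks put at least 1/4 on each of \<open>0\<close>, \<open>x\<close>,
      \<open>y\<close>, so the cost is at most 1/2. With \<epsilon> = 0 the extra move is
      void.\<close>
    then have "overlap_cond (1/4) x y 0 0 0 {0, x, y}"
      using d1 assms by (cases "x = 8") (simp_all add: overlap_cond_def fan_pmf)
    then show ?thesis
      by blast
  next
    case 6
    have "2 \<le> gdist (fan_graph 9) x y"
      using 6 by (intro fan.gdist_ge_2 [OF V]) (auto simp: fan_nbhd)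
    \<comment> \<open>At distance 2 any common mass suffices, and the two walks share at least 1/3
      at the hub.\<close>
    then have "overlap_cond 0 x y 0 0 0 {0}"
      using 6 assms by (cases "x = 1"; cases "y = 9") (simp_all add: overlap_cond_def fan_pmf)
    then show ?thesis
      by blast
  qed
qed

lemma fan_positively_curved: "positively_lly_curved (fan_graph 9)"
  unfolding positively_lly_curved_def
proof (intro ballI impI)
  fix x y assume "x \<in> verts (fan_graph 9)" "y \<in> verts (fan_graph 9)" "x \<noteq> y"
  then have xy: "x \<le> 9" "y \<le> 9" "x \<noteq> y"
    by (auto simp: fan_verts)
  have "\<exists>\<alpha> a b \<epsilon> T. overlap_cond \<alpha> x y a b \<epsilon> T"
  proof (cases "x < y")
    case True
    then show ?thesis
      using fan_overlap_cond xy by blast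
  next
    case False
    then show ?thesis
      using fan_overlap_cond [of y x] xy overlap_cond_commute by (metis linorder_neqE_nat)
  qed
  then show "lly_curvature (fan_graph 9) x y > 0"
    using overlap_cond_imp_pos xy by blast
qed

section \<open>Extremal degrees and the final statement\<close>

lemma fan_degree_bounds:
  assumes "v \<in> verts (fan_graph 9)"
  shows "2 \<le> vdegree (fan_graph 9) v" "vdegree (fan_graph 9) v \<le> 9"
  using assms fan_degree_0 [of 9] fan_degree [of 9 v] by (cases "v = 0"; auto simp: fan_verts)+

lemma max_degree_le_9:
  assumes "simple_graph G" "connected_graph G" "locally_finite G" "positively_lly_curved G"
    "outerplanar G" "min_degree G \<ge> 2"
  shows "max_degree G \<le> 9"
proof -
  have deg: "2 \<le> vdegree G v" if "v \<in> verts G" for v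
  proof -
    have "2 \<le> enat (vdegree G v)"
      using assms(6) that unfolding min_degree_def by (meson INF_lower order_trans)
    then show ?thesis
      by (simp add: numeral_eq_enat)
  qed
  interpret lly_graph G
  proof
    show "nbhd G v \<noteq> {}" if "v \<in> verts G" for v
      using deg [OF that] by (auto simp: vdegree_def)
  qed (use assms in auto)
  have "vdegree G x \<le> 9" if "x \<in> verts G" for x
  proof (rule vdegree_le_9 [OF assms(5) that _ deg])
    fix y assume "y \<in> nbhd G x"
    then have "y \<in> verts G" "x \<noteq> y"
      using nbhd_verts [of x] not_self_nbhd [of x] by auto
    then show "lly_curvature G x y > 0"
      using assms(4) that unfolding positively_lly_curved_def by simp
  qed
  then show ?thesis
    unfolding max_degree_def by (intro SUP_least) (simp add: numeral_eq_enat)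
qed

theorem theorem1p4:
  "(\<forall>G :: 'a graph.
      simple_graph G \<and> connected_graph G \<and> locally_finite G \<and>
      positively_lly_curved G \<and> outerplanar G \<and> min_degree G \<ge> 2 \<longrightarrow>
      max_degree G \<le> 9) \<and>
   (\<exists>G :: nat graph.
      simple_graph G \<and> connected_graph G \<and> locally_finite G \<and>
      positively_lly_curved G \<and> outerplanar G \<and> min_degree G \<ge> 2 \<and>
      max_degree G = 9) \<and>
   (simple_graph (fan_graph 9) \<and> connected_graph (fan_graph 9) \<and> locally_finite (fan_graph 9) \<and>
    positively_lly_curved (fan_graph 9) \<and> outerplanar (fan_graph 9) \<and>
    min_degree (fan_graph 9) \<ge> 2 \<and> max_degree (fan_graph 9) = 9)"
proof -
  have min: "min_degree (fan_graph 9) \<ge> 2"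
    unfolding min_degree_def using fan_degree_bounds(1)
    by (intro INF_greatest) (simp add: numeral_eq_enat)
  have "enat (vdegree (fan_graph 9) 0) \<le> max_degree (fan_graph 9)"
    unfolding max_degree_def by (intro SUP_upper) (simp add: fan_verts)
  moreover have "max_degree (fan_graph 9) \<le> 9"
    unfolding max_degree_def using fan_degree_bounds(2)
    by (intro SUP_least) (simp add: numeral_eq_enat)
  ultimately have "max_degree (fan_graph 9) = 9"
    by (simp add: fan_degree_0 numeral_eq_enat)
  then have fan: "simple_graph (fan_graph 9) \<and> connected_graph (fan_graph 9) \<and>
      locally_finite (fan_graph 9) \<and> positively_lly_curved (fan_graph 9) \<and>
      outerplanar (fan_graph 9) \<and> min_degree (fan_graph 9) \<ge> 2 \<and> max_degree (fan_graph 9) = 9"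
    using fan.simple fan.conn fan.lfin fan_positively_curved fan_outerplanar min by blast
  then show ?thesis
    using max_degree_le_9 by blast
qed

end
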